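(* For every $\lambda>0$, the map $$\mathbb{N}\ni N\ \mapsto\ \inf_{\varrho^{(N)}}\ \tfrac1N\,\mathcal{E}^{(N)}_{\lambda}\big(\varrho^{(N)}\big)$$ is monotonic increasing (i.e. non-decreasing), where the infimum is taken over all permutation-symmetric probability densities $\varrho^{(N)}$ on $\mathbb{R}^{3N}$ with $\sqrt{\varrho^{(N)}}\in H^1(\mathbb{R}^{3N})$.
   Context: Fix constants $\hbar,m,e>0$ and $z\neq0$. For $N\in\mathbb{N}$, $\lambda>0$, and a probability density $\varrho^{(N)}$ on $\mathbb{R}^{3N}=(\mathbb{R}^3)^N$, invariant under permutations of the $N$ factors, with $\sqrt{\varrho^{(N)}}\in H^1(\mathbb{R}^{3N})$, the quantum energy functional is $$\mathcal{E}^{(N)}_\lambda(\varrho^{(N)})=\tfrac{\hbar^2}{8m}\,4\int_{\mathbb{R}^{3N}}\big|\nabla\sqrt{\varrho^{(N)}}\big|^2d^{3N}q+z^2e^2\int_{\mathbb{R}^{3N}}\Big(-\lambda\sum_{k=1}^N\frac1{|q_k|}+\frac1N\sum_{1\le k<l\le N}\frac1{|q_k-q_l|}\Big)\varrho^{(N)}\,d^{3N}q,$$ the double sum being $0$ for $N=1$. (The infimum of $\tfrac1N\mathcal{E}^{(N)}_\lambda$ equals $N^{-3}$ times the bosonic ground state energy of the Born--Oppenheimer ion Hamiltonian with $N$ bosonic electrons and nuclear charge number $Z=\lambda N$.) *)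

theory Defs
  imports "HOL-Analysis.Analysis"
begin

type_synonym config = "nat \<Rightarrow> real^3"

(* (R^3)^N with Lebesgue measure, particles being numbered 0, ..., N - 1. Points are the functions
   in PiE {..<N} (\<lambda>_. UNIV), so the topology induced by the product topology on config is the
   usual one. *)
definition config_space :: "nat \<Rightarrow> config measure" where
  "config_space N = (\<Pi>\<^sub>M k\<in>{..<N}. lborel)"

definition partial_deriv :: "nat \<Rightarrow> 3 \<Rightarrow> (config \<Rightarrow> real) \<Rightarrow> config \<Rightarrow> real" where
  "partial_deriv k i \<phi> q = deriv (\<lambda>t. \<phi> (q(k := q k + t *\<^sub>R axis i 1))) 0"

(* The class C^n on (R^3)^N: all partial derivatives up to order n exist and are continuous. *)
primrec cont_diff :: "nat \<Rightarrow> nat \<Rightarrow> (config \<Rightarrow> real) \<Rightarrow> bool" where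
  "cont_diff N 0 \<phi> \<longleftrightarrow> continuous_on (space (config_space N)) \<phi>"
| "cont_diff N (Suc n) \<phi> \<longleftrightarrow>
     continuous_on (space (config_space N)) \<phi> \<and>
     (\<forall>k<N. \<forall>i.
        (\<forall>q\<in>space (config_space N).
           (\<lambda>t. \<phi> (q(k := q k + t *\<^sub>R axis i 1))) field_differentiable (at 0)) \<and>
        cont_diff N n (partial_deriv k i \<phi>))"

definition test_functions :: "nat \<Rightarrow> (config \<Rightarrow> real) set" where
  "test_functions N = {\<phi>. (\<forall>n. cont_diff N n \<phi>) \<and>
     (\<exists>K. compact K \<and> K \<subseteq> space (config_space N) \<and> (\<forall>q\<in>space (config_space N) - K. \<phi> q = 0))}"

definition square_integrable :: "'a measure \<Rightarrow> ('a \<Rightarrow> 'b::euclidean_space) \<Rightarrow> bool" where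
  "square_integrable M f \<longleftrightarrow> f \<in> borel_measurable M \<and> integrable M (\<lambda>x. (norm (f x))\<^sup>2)"

(* g k is the R^3-valued k-th block of the distributional gradient, required to be in L^2. *)
definition has_weak_gradient :: "nat \<Rightarrow> (config \<Rightarrow> real) \<Rightarrow> (nat \<Rightarrow> config \<Rightarrow> real^3) \<Rightarrow> bool" where
  "has_weak_gradient N \<psi> g \<longleftrightarrow>
     (\<forall>k<N. square_integrable (config_space N) (g k) \<and>
       (\<forall>i. \<forall>\<phi>\<in>test_functions N.
          (LINT q|config_space N. \<psi> q * partial_deriv k i \<phi> q) =
          - (LINT q|config_space N. g k q $ i * \<phi> q)))"

definition H1 :: "nat \<Rightarrow> (config \<Rightarrow> real) set" where
  "H1 N = {\<psi>. square_integrable (config_space N) \<psi> \<and> (\<exists>g. has_weak_gradient N \<psi> g)}"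

(* Almost everywhere unique, so the integral below does not depend on the choice. *)
definition weak_gradient :: "nat \<Rightarrow> (config \<Rightarrow> real) \<Rightarrow> nat \<Rightarrow> config \<Rightarrow> real^3" where
  "weak_gradient N \<psi> = (SOME g. has_weak_gradient N \<psi> g)"

(* Densities represent elements of L^1, hence the pointwise conditions hold almost everywhere. *)
definition admissible_densities :: "nat \<Rightarrow> (config \<Rightarrow> real) set" where
  "admissible_densities N = {\<rho>.
     (AE q in config_space N. 0 \<le> \<rho> q) \<and>
     has_bochner_integral (config_space N) \<rho> 1 \<and>
     (\<forall>\<sigma>. \<sigma> permutes {..<N} \<longrightarrow> (AE q in config_space N. \<rho> (q \<circ> \<sigma>) = \<rho> q)) \<and>
     (\<lambda>q. sqrt (\<rho> q)) \<in> H1 N}"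

(* For admissible \<rho> the potential is integrable against \<rho> by Hardy's inequality, so the second
   integral is not a default value; the convention 1 / 0 = 0 matters only on a null set. *)
definition energy ::
  "real \<Rightarrow> real \<Rightarrow> real \<Rightarrow> real \<Rightarrow> real \<Rightarrow> nat \<Rightarrow> (config \<Rightarrow> real) \<Rightarrow> real" where
  "energy hbar m e z lam N \<rho> =
     hbar\<^sup>2 / (8 * m) *
       (4 * (LINT q|config_space N. (\<Sum>k<N. (norm (weak_gradient N (\<lambda>q. sqrt (\<rho> q)) k q))\<^sup>2))) +
     z\<^sup>2 * e\<^sup>2 *
       (LINT q|config_space N.
          (- lam * (\<Sum>k<N. 1 / norm (q k)) +
           1 / real N * (\<Sum>l<N. \<Sum>k<l. 1 / norm (q k - q l))) * \<rho> q)"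

end

theory Submission
  imports Defs
begin

text \<open>
  Given an admissible density of \<open>N + 1\<close> particles, freeze the last particle at \<open>y\<close> and normalise: for
  almost every \<open>y\<close> of positive weight this is an admissible density of \<open>N\<close> particles, so the infimum for \<open>N\<close> bounds its
  energy from below. Averaging over \<open>y\<close> with the weight that was divided out, and using permutation
  symmetry, gives a lower bound with the same kinetic and nuclear energy per particle as the
  \<open>(N + 1)\<close>-particle density, but with the factor \<open>(N - 1) / (2 N)\<close> instead of \<open>N / (2 (N + 1))\<close> in
  front of the nonnegative pair repulsion. Slicing avoids the convexity of the Fisher information
  that the comparison with the marginal density would need.

  Weak derivatives are handled through the identity
  \<open>\<psi> (q + h u) - \<psi> q = \<integral>\<^sub>0\<^sup>h G (q + t u) dt\<close> for almost every \<open>q\<close>: it is equivalent to \<open>G\<close> being the weak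
  derivative of \<open>\<psi>\<close> along \<open>u\<close>, passes to slices by Fubini, and yields the Hardy inequality that makes the
  Coulomb potentials integrable.
\<close>

section \<open>Configuration space\<close>

text \<open>A weak gradient is defined by a condition on every smooth compactly supported function.
  On slices this is the obstacle: the null set of bad \<open>y\<close> could depend on the test
  function, and there are uncountably many of these. The translation identity removes it, because
  the steps \<open>1 / real (Suc n)\<close> already determine the weak derivative, so only countably
  many null sets are discarded. The two directions are asymmetric: reaching the identity uses only
  products of functions of one real variable, while the way back has to serve every test function.
  What remains is \<open>(N - 1) / (2 N) \<le> N / (2 (N + 1))\<close>, that is
  \<open>N^2 - 1 \<le> N^2\<close>. No lower bound on the energy is proved: the infima live in
  \<open>ereal\<close>.\<close>

interpretation lb: product_sigma_finite "\<lambda>_::nat. lborel :: (real^3) measure"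
  by standard

lemma space_config_space: "space (config_space N) = (\<Pi>\<^sub>E k\<in>{..<N}. UNIV)"
  by (simp add: config_space_def space_PiM)

lemma sigma_finite_config_space: "sigma_finite_measure (config_space N)"
  unfolding config_space_def by (rule lb.sigma_finite) simp

interpretation cs: sigma_finite_measure "config_space N" for N
  by (rule sigma_finite_config_space)

interpretation csl: pair_sigma_finite "config_space N" "lborel :: 'a::euclidean_space measure" for N
  by standard

interpretation lcs: pair_sigma_finite "lborel :: 'a::euclidean_space measure" "config_space N" for N
  by standard

lemma measurable_coord [measurable]: "k < N \<Longrightarrow> (\<lambda>q. q k) \<in> borel_measurable (config_space N)"
  unfolding config_space_def
  using measurable_component_singleton[of k "{..<N}" "\<lambda>_. lborel :: (real^3) measure"] by simp

lemma measurable_vec_nth [measurable]: "(\<lambda>x::real^'n. x $ i) \<in> borel_measurable borel"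
  by (intro borel_measurable_continuous_onI continuous_intros)

lemma measurable_config_space_upd [measurable]:
  assumes "k < N" "f \<in> measurable M (config_space N)" "h \<in> borel_measurable M"
  shows "(\<lambda>x. (f x)(k := h x)) \<in> measurable M (config_space N)"
  using assms unfolding config_space_def
  by (intro measurable_fun_upd[where J="{..<N}"]) auto

lemma measurable_config_space_ext [measurable]:
  assumes "f \<in> measurable M (config_space N)" "h \<in> borel_measurable M"
  shows "(\<lambda>x. (f x)(N := h x)) \<in> measurable M (config_space (Suc N))"
  using assms unfolding config_space_def
  by (intro measurable_fun_upd[where J="{..<N}"]) auto

lemma sets_config_spaceI:
  "(\<And>k. k < N \<Longrightarrow> A k \<in> sets borel) \<Longrightarrow> Pi\<^sub>E {..<N} A \<in> sets (config_space N)"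
  unfolding config_space_def by (rule sets_PiM_I_finite) auto

lemma emeasure_config_space:
  "(\<And>k. k < N \<Longrightarrow> A k \<in> sets borel) \<Longrightarrow>
    emeasure (config_space N) (Pi\<^sub>E {..<N} A) = (\<Prod>k<N. emeasure lborel (A k))"
  unfolding config_space_def by (rule lb.emeasure_PiM) auto

text \<open>Rectangles determine a product measure, so for translations, permutations and the
  appending of a particle it is enough to compute preimages of rectangles.\<close>

lemma config_space_eqI:
  assumes T: "T \<in> measurable M (config_space N)"
    and eq: "\<And>A. (\<And>k. k < N \<Longrightarrow> A k \<in> sets borel) \<Longrightarrow>
      emeasure M (T -` Pi\<^sub>E {..<N} A \<inter> space M) = (\<Prod>k<N. emeasure lborel (A k))"
  shows "distr M (config_space N) T = config_space N"
  unfolding config_space_def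
proof (rule lb.PiM_eqI)
  fix A :: "nat \<Rightarrow> (real^3) set" assume "\<And>i. i \<in> {..<N} \<Longrightarrow> A i \<in> sets lborel"
  then show "emeasure (distr M (Pi\<^sub>M {..<N} (\<lambda>k. lborel)) T) (Pi\<^sub>E {..<N} A) = (\<Prod>i<N. emeasure lborel (A i))"
    using eq[of A] T by (subst emeasure_distr) (auto simp: config_space_def intro!: sets_PiM_I_finite)
qed auto

section \<open>Measure-preserving maps: translations, permutations, appending a particle\<close>

definition shift :: "nat \<Rightarrow> 3 \<Rightarrow> real \<Rightarrow> config \<Rightarrow> config" where
  "shift k i t q = q(k := q k + t *\<^sub>R axis i 1)"

lemma shift_0 [simp]: "shift k i 0 q = q"
  by (simp add: shift_def)

lemma shift_shift [simp]: "shift k i s (shift k i t q) = shift k i (t + s) q"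
  by (simp add: shift_def fun_eq_iff algebra_simps)

lemma shift_in_space [simp]:
  "k < N \<Longrightarrow> q \<in> space (config_space N) \<Longrightarrow> shift k i t q \<in> space (config_space N)"
  by (auto simp: space_config_space shift_def PiE_def extensional_def)

lemma measurable_shift [measurable]:
  assumes "k < N" "f \<in> measurable M (config_space N)" "h \<in> borel_measurable M"
  shows "(\<lambda>x. shift k i (h x) (f x)) \<in> measurable M (config_space N)"
proof -
  have [measurable]: "(\<lambda>x. f x k) \<in> borel_measurable M"
    by (rule measurable_compose[OF assms(2) measurable_coord[OF assms(1)]])
  note [measurable] = assms
  show ?thesis unfolding shift_def using assms(1) by measurable
qed

lemma distr_shift:
  assumes k: "k < N"
  shows "distr (config_space N) (config_space N) (shift k i t) = config_space N"
proof (rule config_space_eqI)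
  show "shift k i t \<in> measurable (config_space N) (config_space N)"
    using measurable_shift[OF k measurable_ident measurable_const[of t borel]] by simp
  fix A :: "nat \<Rightarrow> (real^3) set" assume A: "\<And>k. k < N \<Longrightarrow> A k \<in> sets borel"
  let ?c = "t *\<^sub>R axis i 1 :: real^3"
  let ?B = "A(k := (+) ?c -` A k)"
  have B: "(+) ?c -` A k \<in> sets borel"
    using measurable_sets[of "(+) ?c" borel borel "A k"] A[OF k] by simp
  have "shift k i t -` Pi\<^sub>E {..<N} A \<inter> space (config_space N) = Pi\<^sub>E {..<N} ?B"
  proof (rule set_eqI)
    fix q
    have "(\<forall>j<N. shift k i t q j \<in> A j) \<longleftrightarrow> (\<forall>j<N. q j \<in> ?B j)"
      by (simp add: shift_def add.commute[of "q k"])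
    moreover have "(\<forall>j. \<not> j < N \<longrightarrow> shift k i t q j = undefined) \<longleftrightarrow> (\<forall>j. \<not> j < N \<longrightarrow> q j = undefined)"
      using k by (auto simp: shift_def)
    ultimately show "q \<in> shift k i t -` Pi\<^sub>E {..<N} A \<inter> space (config_space N) \<longleftrightarrow> q \<in> Pi\<^sub>E {..<N} ?B"
      unfolding space_config_space vimage_def Int_iff mem_Collect_eq PiE_iff extensional_def Ball_def lessThan_iff
      by (simp only: UNIV_I simp_thms) blast
  qed
  moreover have "emeasure (config_space N) (Pi\<^sub>E {..<N} ?B) = (\<Prod>k<N. emeasure lborel (?B k))"
    by (rule emeasure_config_space) (use A B in \<open>auto simp: fun_upd_def\<close>)
  moreover have "emeasure lborel (?B j) = emeasure lborel (A j)" if "j < N" for j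
  proof (cases "j = k")
    case True
    have "emeasure lborel ((+) ?c -` A k) = emeasure (distr lborel borel ((+) ?c)) (A k)"
      using A[OF k] by (subst emeasure_distr) auto
    then show ?thesis using True by (simp add: lborel_distr_plus)
  qed auto
  ultimately show "emeasure (config_space N) (shift k i t -` Pi\<^sub>E {..<N} A \<inter> space (config_space N)) = (\<Prod>k<N. emeasure lborel (A k))"
    by simp
qed

lemma distr_permute:
  assumes s: "s permutes {..<N}"
  shows "distr (config_space N) (config_space N) (\<lambda>q. q \<circ> s) = config_space N"
    and "(\<lambda>q. q \<circ> s) \<in> measurable (config_space N) (config_space N)"
proof -
  have sN: "s k < N \<longleftrightarrow> k < N" for k using permutes_in_image[OF s, of k] by simp
  show m: "(\<lambda>q. q \<circ> s) \<in> measurable (config_space N) (config_space N)"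
    unfolding config_space_def
  proof (rule measurable_PiM_single')
    fix i assume "i \<in> {..<N}"
    then show "(\<lambda>q. (q \<circ> s) i) \<in> Pi\<^sub>M {..<N} (\<lambda>k. lborel) \<rightarrow>\<^sub>M lborel"
      using sN[of i] measurable_component_singleton[of "s i" "{..<N}" "\<lambda>_. lborel :: (real^3) measure"]
      by (simp add: o_def)
  next
    show "(\<lambda>q. q \<circ> s) \<in> space (Pi\<^sub>M {..<N} (\<lambda>k. lborel)) \<rightarrow> ({..<N} \<rightarrow>\<^sub>E space lborel)"
      using sN by (auto simp: space_PiM PiE_iff extensional_def)
  qed
  show "distr (config_space N) (config_space N) (\<lambda>q. q \<circ> s) = config_space N"
  proof (rule config_space_eqI[OF m])
    fix A :: "nat \<Rightarrow> (real^3) set" assume A: "\<And>k. k < N \<Longrightarrow> A k \<in> sets borel"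
    \<comment> \<open>Coordinate \<open>k\<close> of \<open>q\<close> is coordinate
      \<open>inv s k\<close> of \<open>q \<circ> s\<close>, so the sides of a preimage are permuted
      by the inverse, and the product of their volumes is unchanged.\<close>
    let ?r = "inv s"
    have r: "?r permutes {..<N}" by (rule permutes_inv[OF s])
    have rN: "?r k < N \<longleftrightarrow> k < N" for k using permutes_in_image[OF r, of k] by simp
    have "(\<lambda>q. q \<circ> s) -` Pi\<^sub>E {..<N} A \<inter> space (config_space N) = Pi\<^sub>E {..<N} (A \<circ> ?r)"
    proof (rule set_eqI)
      fix q
      have "(\<forall>k<N. q (s k) \<in> A k) \<longleftrightarrow> (\<forall>k<N. q k \<in> A (?r k))"
        by (metis rN sN permutes_inverses(1,2)[OF s])
      moreover have "(\<forall>k. \<not> k < N \<longrightarrow> q k = undefined) \<Longrightarrow> (\<forall>k. \<not> k < N \<longrightarrow> q (s k) = undefined)"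
        using sN by auto
      ultimately show "q \<in> (\<lambda>q. q \<circ> s) -` Pi\<^sub>E {..<N} A \<inter> space (config_space N) \<longleftrightarrow> q \<in> Pi\<^sub>E {..<N} (A \<circ> ?r)"
        by (auto simp: space_config_space PiE_iff extensional_def)
    qed
    moreover have "emeasure (config_space N) (Pi\<^sub>E {..<N} (A \<circ> ?r)) = (\<Prod>k<N. emeasure lborel ((A \<circ> ?r) k))"
      by (rule emeasure_config_space) (use A rN in auto)
    moreover have "(\<Prod>k<N. emeasure lborel ((A \<circ> ?r) k)) = (\<Prod>k<N. emeasure lborel (A k))"
      using prod.permute[OF r, of "\<lambda>k. emeasure lborel (A k)"] by (simp add: o_def)
    ultimately show "emeasure (config_space N) ((\<lambda>q. q \<circ> s) -` Pi\<^sub>E {..<N} A \<inter> space (config_space N)) = (\<Prod>k<N. emeasure lborel (A k))"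
      by simp
  qed
qed

text \<open>The appended position comes first in the pair because it is the outer variable later on:
  almost every \<open>y\<close>, then almost every \<open>q\<close>.\<close>

lemma distr_ext:
  "distr (lborel \<Otimes>\<^sub>M config_space N) (config_space (Suc N)) (\<lambda>(y, q). q(N := y)) = config_space (Suc N)"
proof (rule config_space_eqI)
  show "(\<lambda>(y, q). q(N := y)) \<in> lborel \<Otimes>\<^sub>M config_space N \<rightarrow>\<^sub>M config_space (Suc N)"
    unfolding case_prod_beta by measurable
  fix A :: "nat \<Rightarrow> (real^3) set" assume A: "\<And>k. k < Suc N \<Longrightarrow> A k \<in> sets borel"
  have "(\<lambda>(y, q). q(N := y)) -` Pi\<^sub>E {..<Suc N} A \<inter> space (lborel \<Otimes>\<^sub>M config_space N) =
      A N \<times> Pi\<^sub>E {..<N} A"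
    by (auto simp: space_pair_measure space_config_space PiE_iff extensional_def less_Suc_eq split: if_splits)
  moreover have "emeasure (lborel \<Otimes>\<^sub>M config_space N) (A N \<times> Pi\<^sub>E {..<N} A) =
      emeasure lborel (A N) * emeasure (config_space N) (Pi\<^sub>E {..<N} A)"
    by (rule cs.emeasure_pair_measure_Times) (use A in \<open>auto intro!: sets_config_spaceI\<close>)
  moreover have "emeasure (config_space N) (Pi\<^sub>E {..<N} A) = (\<Prod>k<N. emeasure lborel (A k))"
    by (rule emeasure_config_space) (use A in auto)
  ultimately show "emeasure (lborel \<Otimes>\<^sub>M config_space N) ((\<lambda>(y, q). q(N := y)) -` Pi\<^sub>E {..<Suc N} A \<inter> space (lborel \<Otimes>\<^sub>M config_space N)) = (\<Prod>k<Suc N. emeasure lborel (A k))"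
    by (simp add: mult.commute)
qed

lemma integrable_preserving:
  fixes f :: "'a \<Rightarrow> 'b::{banach, second_countable_topology}"
  assumes "distr M M' T = M'" "T \<in> measurable M M'"
  shows "integrable M' f \<Longrightarrow> integrable M (\<lambda>x. f (T x))"
  using integrable_distr[OF assms(2), of f] assms(1) by simp

lemma integral_preserving:
  fixes f :: "'a \<Rightarrow> 'b::{banach, second_countable_topology}"
  assumes "distr M M' T = M'" "T \<in> measurable M M'" "f \<in> borel_measurable M'"
  shows "(LINT x|M. f (T x)) = (LINT x|M'. f x)"
  using integral_distr[OF assms(2,3)] assms(1) by simp

lemma nn_integral_preserving:
  assumes "distr M M' T = M'" "T \<in> measurable M M'" "f \<in> borel_measurable M'"
  shows "(\<integral>\<^sup>+x. f (T x) \<partial>M) = (\<integral>\<^sup>+x. f x \<partial>M')"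
  using nn_integral_distr[OF assms(2), of f] assms(1,3) by simp

lemma AE_preserving:
  assumes "distr M M' T = M'" "T \<in> measurable M M'" "AE x in M'. P x"
  shows "AE x in M. P (T x)"
proof -
  have "AE x in distr M M' T. P x"
    unfolding assms(1) by (rule assms(3))
  then show ?thesis by (rule AE_distrD[OF assms(2)])
qed

lemma shift_measurable [measurable]:
  "k < N \<Longrightarrow> shift k i t \<in> measurable (config_space N) (config_space N)"
  using measurable_shift[OF _ measurable_ident measurable_const[of t borel], of k N i] by simp

lemma ext_measurable [measurable]:
  "(\<lambda>(y, q). q(N := y)) \<in> lborel \<Otimes>\<^sub>M config_space N \<rightarrow>\<^sub>M config_space (Suc N)"
  unfolding case_prod_beta by measurable

section \<open>Smooth product test functions\<close>

text \<open>The derivative is an existential witness rather than \<open>deriv\<close>, so closure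
  under sums and products only requires naming the derivative.\<close>

primrec cdiff :: "nat \<Rightarrow> (real \<Rightarrow> real) \<Rightarrow> bool" where
  "cdiff 0 f \<longleftrightarrow> continuous_on UNIV f"
| "cdiff (Suc n) f \<longleftrightarrow> (\<exists>f'. (\<forall>x. (f has_real_derivative f' x) (at x)) \<and> cdiff n f')"

definition smooth :: "(real \<Rightarrow> real) \<Rightarrow> bool" where
  "smooth f \<longleftrightarrow> (\<forall>n. cdiff n f)"

lemma cdiff_Suc_imp: "cdiff (Suc n) f \<Longrightarrow> cdiff n f"
proof (induction n arbitrary: f)
  case 0
  then obtain f' where "\<And>x. (f has_real_derivative f' x) (at x)" by auto
  then show ?case unfolding cdiff.simps by (intro continuous_at_imp_continuous_on ballI DERIV_isCont)
next
  case (Suc n)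
  from Suc.prems obtain f' where "\<forall>x. (f has_real_derivative f' x) (at x)" "cdiff (Suc n) f'"
    unfolding cdiff.simps(2)[of "Suc n"] by blast
  then show ?case using Suc.IH[of f'] unfolding cdiff.simps(2)[of n] by blast
qed

lemma cdiff_add: "cdiff n f \<Longrightarrow> cdiff n g \<Longrightarrow> cdiff n (\<lambda>x. f x + g x)"
proof (induction n arbitrary: f g)
  case 0
  then show ?case by (auto intro: continuous_on_add)
next
  case (Suc n)
  from Suc.prems obtain f' g' where
    "\<And>x. (f has_real_derivative f' x) (at x)" "cdiff n f'"
    "\<And>x. (g has_real_derivative g' x) (at x)" "cdiff n g'" by auto
  then show ?case using Suc.IH by (auto intro!: exI[of _ "\<lambda>x. f' x + g' x"] DERIV_add)
qed

lemma cdiff_mult: "cdiff n f \<Longrightarrow> cdiff n g \<Longrightarrow> cdiff n (\<lambda>x. f x * g x)"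
proof (induction n arbitrary: f g)
  case 0
  then show ?case by (auto intro: continuous_on_mult)
next
  case (Suc n)
  from Suc.prems obtain f' g' where
    *: "\<And>x. (f has_real_derivative f' x) (at x)" "cdiff n f'"
    "\<And>x. (g has_real_derivative g' x) (at x)" "cdiff n g'" by auto
  have "cdiff n (\<lambda>x. f' x * g x + g' x * f x)"
    using * Suc.IH cdiff_Suc_imp[OF Suc.prems(1)] cdiff_Suc_imp[OF Suc.prems(2)]
    by (intro cdiff_add) auto
  then show ?case
    using * by (auto intro!: exI[of _ "\<lambda>x. f' x * g x + g' x * f x"] DERIV_mult)
qed

lemma cdiff_const: "cdiff n (\<lambda>x. c)"
proof (induction n arbitrary: c)
  case (Suc n)
  then show ?case by (auto intro!: exI[of _ "\<lambda>_. 0"])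
qed simp

lemma cdiff_affine: "cdiff n f \<Longrightarrow> cdiff n (\<lambda>x. f (u * x + v))"
proof (induction n arbitrary: f)
  case 0
  then show ?case by (auto intro!: continuous_on_compose2[of UNIV f] continuous_intros)
next
  case (Suc n)
  from Suc.prems obtain f' where
    *: "\<And>x. (f has_real_derivative f' x) (at x)" "cdiff n f'" by auto
  have "((\<lambda>x. f (u * x + v)) has_real_derivative f' (u * x + v) * u) (at x)" for x
    by (rule DERIV_chain2[OF *(1)]) (auto intro!: derivative_eq_intros)
  moreover have "cdiff n (\<lambda>x. f' (u * x + v) * u)"
    by (intro cdiff_mult cdiff_const Suc.IH *)
  ultimately show ?case unfolding cdiff.simps
    by (intro exI[of _ "\<lambda>x. f' (u * x + v) * u"]) simp
qed

lemma smooth_mult: "smooth f \<Longrightarrow> smooth g \<Longrightarrow> smooth (\<lambda>x. f x * g x)"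
  by (simp add: smooth_def cdiff_mult)

lemma smooth_affine: "smooth f \<Longrightarrow> smooth (\<lambda>x. f (u * x + v))"
  by (simp add: smooth_def cdiff_affine)

lemma smoothI:
  assumes "\<And>x. (f has_real_derivative f' x) (at x)" "smooth f'"
  shows "smooth f"
  unfolding smooth_def
proof
  fix n
  have "cdiff n f'" using assms(2) by (simp add: smooth_def)
  then have "cdiff (Suc n) f" using assms(1) unfolding cdiff.simps by blast
  then show "cdiff n f" by (rule cdiff_Suc_imp)
qed

lemma smooth_has_deriv:
  assumes "smooth f"
  shows "(f has_real_derivative deriv f x) (at x)" and "smooth (deriv f)"
proof -
  have *: "(f has_real_derivative deriv f x) (at x)" for x
  proof -
    have "cdiff (Suc 0) f" using assms by (simp only: smooth_def)
    then obtain f' where "\<And>x. (f has_real_derivative f' x) (at x)" by auto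
    then show ?thesis using DERIV_imp_deriv[of f "f' x" x] by simp
  qed
  show "(f has_real_derivative deriv f x) (at x)" by fact
  show "smooth (deriv f)" unfolding smooth_def
  proof
    fix n
    have "cdiff (Suc n) f" using assms by (simp only: smooth_def)
    then obtain f' where f': "\<And>x. (f has_real_derivative f' x) (at x)" "cdiff n f'" by auto
    then have "f' = deriv f" by (metis DERIV_imp_deriv ext)
    with f' show "cdiff n (deriv f)" by simp
  qed
qed

lemma smooth_continuous: "smooth f \<Longrightarrow> continuous_on UNIV f"
  unfolding smooth_def using cdiff.simps(1) by blast

section \<open>Bump functions built from \<open>exp (- c / x)\<close>\<close>

lemma poly_exp_tendsto_0:
  "c > 0 \<Longrightarrow> ((\<lambda>y::real. poly p y * exp (- c * y)) \<longlongrightarrow> 0) at_top"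
proof (induction p arbitrary: c)
  case 0
  then show ?case by simp
next
  case (pCons a p)
  have pow: "((\<lambda>y. (d * y) ^ k * exp (- d * y)) \<longlongrightarrow> 0) at_top" if "d > 0" for d :: real and k
    using filterlim_compose[OF tendsto_power_div_exp_0 filterlim_tendsto_pos_mult_at_top[OF tendsto_const that filterlim_ident], of k]
    by (simp add: exp_minus field_simps)
  have "((\<lambda>y. exp (- c * y)) \<longlongrightarrow> 0) at_top" using pow[OF pCons.prems, of 0] by simp
  then have 1: "((\<lambda>y. a * exp (- c * y)) \<longlongrightarrow> a * 0) at_top" by (intro tendsto_intros)
  \<comment> \<open>Half of the rate absorbs the factor \<open>y\<close>, the other half the
    polynomial \<open>p\<close>; hence the rate is arbitrary in the induction.\<close>
  have 2: "((\<lambda>y. y * exp (- (c/2) * y)) \<longlongrightarrow> 0) at_top"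
    using tendsto_mult_left[OF pow[of "c/2" 1], of "2/c"] pCons.prems by (simp add: field_simps)
  have 3: "((\<lambda>y. (y * exp (- (c/2) * y)) * (poly p y * exp (- (c/2) * y))) \<longlongrightarrow> 0 * 0) at_top"
    using pCons.prems by (intro tendsto_mult[OF 2] pCons.IH) auto
  have "(\<lambda>y. poly (pCons a p) y * exp (- c * y)) =
      (\<lambda>y. a * exp (- c * y) + (y * exp (- (c/2) * y)) * (poly p y * exp (- (c/2) * y)))"
  proof
    fix y
    have "exp (- c * y) = exp (- (c/2) * y) * exp (- (c/2) * y)"
      by (simp flip: exp_add)
    then show "poly (pCons a p) y * exp (- c * y) = a * exp (- c * y) + (y * exp (- (c/2) * y)) * (poly p y * exp (- (c/2) * y))"
      by (simp add: algebra_simps)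
  qed
  then show ?case using tendsto_add[OF 1 3] by simp
qed

text \<open>Closing the functions \<open>exp (- c / x)\<close> under polynomial factors in \<open>1 / x\<close> makes the class stable under
  differentiation; letting \<open>c\<close> tend to \<open>0\<close> turns the bumps into indicators of intervals.\<close>

definition flat :: "real \<Rightarrow> real poly \<Rightarrow> real \<Rightarrow> real" where
  "flat c p x = (if 0 < x then poly p (1 / x) * exp (- c / x) else 0)"

text \<open>With \<open>u = 1 / x\<close> the derivative of \<open>p(u) exp (- c u)\<close> is
  \<open>u^2 (c p(u) - p'(u)) exp (- c u)\<close>, again a polynomial in \<open>u\<close> times the
  same exponential. At 0 the right difference quotient is \<open>u p(u) exp (- c u)\<close> with
  \<open>u\<close> tending to infinity.\<close>

lemma flat_has_deriv:
  assumes c: "c > 0"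
  shows "(flat c p has_real_derivative flat c ([:0, 0, 1:] * (smult c p - pderiv p)) x) (at x)"
proof -
  consider "x < 0" | "x = 0" | "x > 0" by linarith
  then show ?thesis
  proof cases
    case 1
    have "((\<lambda>x. 0) has_real_derivative 0) (at x)" by simp
    then have "(flat c p has_real_derivative 0) (at x)"
      by (rule has_field_derivative_transform_within_open[of _ _ _ "{..<0}"]) (use 1 in \<open>auto simp: flat_def\<close>)
    then show ?thesis using 1 by (simp add: flat_def)
  next
    case 3
    have "((\<lambda>x. poly p (1 / x) * exp (- c / x)) has_real_derivative
        flat c ([:0, 0, 1:] * (smult c p - pderiv p)) x) (at x)"
      using 3 by (auto intro!: derivative_eq_intros DERIV_chain2[OF poly_DERIV]
        simp: flat_def field_simps power2_eq_square)
    then show ?thesis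
      by (rule has_field_derivative_transform_within_open[of _ _ _ "{0<..}"]) (use 3 in \<open>auto simp: flat_def\<close>)
  next
    case 2
    have "((\<lambda>h. poly ([:0, 1:] * p) (inverse h) * exp (- c * inverse h)) \<longlongrightarrow> 0) (at_right 0)"
      by (rule filterlim_compose[OF poly_exp_tendsto_0[OF c] filterlim_inverse_at_top_right])
    then have "((\<lambda>h. flat c p h / h) \<longlongrightarrow> 0) (at_right 0)"
      by (rule Lim_transform_eventually)
        (auto simp: eventually_at_right_field flat_def field_simps intro!: exI[of _ 1])
    moreover have "((\<lambda>h. flat c p h / h) \<longlongrightarrow> 0) (at_left 0)"
      by (rule Lim_transform_eventually[OF tendsto_const])
        (auto simp: eventually_at_left_field flat_def intro!: exI[of _ "-1"])
    ultimately have "((\<lambda>h. flat c p h / h) \<longlongrightarrow> 0) (at 0)"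
      using filterlim_split_at_real by blast
    then show ?thesis using 2 by (simp add: DERIV_def) (simp add: flat_def)
  qed
qed

lemma smooth_flat: "c > 0 \<Longrightarrow> smooth (flat c p)"
  unfolding smooth_def
proof
  fix n assume "c > 0"
  then show "cdiff n (flat c p)"
  proof (induction n arbitrary: p)
    case 0
    then show ?case
      unfolding cdiff.simps
      by (intro continuous_at_imp_continuous_on ballI DERIV_isCont[OF flat_has_deriv])
  next
    case (Suc n)
    then show ?case by (subst cdiff.simps) (blast intro: flat_has_deriv)
  qed
qed

definition bump :: "real \<Rightarrow> real \<Rightarrow> real \<Rightarrow> real \<Rightarrow> real" where
  "bump c a b x = flat c 1 (x - a) * flat c 1 (b - x)"

lemma smooth_bump: "c > 0 \<Longrightarrow> smooth (bump c a b)"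
  using smooth_mult[OF smooth_affine[OF smooth_flat, of c 1 1 "-a"] smooth_affine[OF smooth_flat, of c 1 "-1" b]]
  by (simp add: bump_def[abs_def])

lemma flat_bounds: "c > 0 \<Longrightarrow> 0 \<le> flat c 1 x" "c > 0 \<Longrightarrow> flat c 1 x \<le> 1"
  by (auto simp: flat_def)

lemma bump_bounds: "c > 0 \<Longrightarrow> 0 \<le> bump c a b x" "c > 0 \<Longrightarrow> bump c a b x \<le> 1"
  by (auto simp: bump_def flat_bounds intro!: mult_le_one)

lemma bump_outside: "\<not> (a < x \<and> x < b) \<Longrightarrow> bump c a b x = 0"
  by (auto simp: bump_def flat_def)

text \<open>The limit holds at every point, endpoints included, because \<open>flat\<close> vanishes
  at 0; this is why the intervals are open.\<close>

lemma bump_tendsto: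
  "(\<lambda>n. bump (1 / real (Suc n)) a b x) \<longlonglongrightarrow> indicator {a<..<b} x"
proof -
  have *: "(\<lambda>n. flat (1 / real (Suc n)) 1 y) \<longlonglongrightarrow> indicator {0<..} y" for y :: real
  proof (cases "y > 0")
    case True
    have "(\<lambda>n. exp (- (1 / real (Suc n)) / y)) \<longlonglongrightarrow> exp (- 0 / y)"
      using LIMSEQ_inverse_real_of_nat True
      by (intro tendsto_intros) (auto simp: inverse_eq_divide)
    then show ?thesis using True by (simp add: flat_def)
  qed (auto simp: flat_def)
  have eq: "indicator {a<..<b} x = (indicator {0<..} (x - a) * indicator {0<..} (b - x) :: real)"
    by (auto simp: indicator_def)
  then show ?thesis unfolding bump_def eq by (intro tendsto_mult *)
qed

section \<open>Products with one factor for each real coordinate\<close>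

definition tprod :: "nat \<Rightarrow> (nat \<times> 3 \<Rightarrow> real \<Rightarrow> real) \<Rightarrow> config \<Rightarrow> real" where
  "tprod N F q = (\<Prod>p\<in>{..<N} \<times> UNIV. F p (q (fst p) $ snd p))"

text \<open>The cofactor of \<open>F r\<close>. It is constant along the axis \<open>r\<close>, so
  on a line in that direction \<open>tprod\<close> is a constant multiple of a function of one real
  variable.\<close>

definition trest :: "nat \<Rightarrow> nat \<times> 3 \<Rightarrow> (nat \<times> 3 \<Rightarrow> real \<Rightarrow> real) \<Rightarrow> config \<Rightarrow> real" where
  "trest N r F q = (\<Prod>p\<in>{..<N} \<times> UNIV - {r}. F p (q (fst p) $ snd p))"

lemma tprod_split: "k < N \<Longrightarrow> tprod N F q = F (k, i) (q k $ i) * trest N (k, i) F q"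
  by (simp add: tprod_def trest_def prod.remove[of _ "(k, i)"])

lemma trest_upd [simp]: "trest N r (F(r := f)) q = trest N r F q"
  unfolding trest_def by (rule prod.cong) auto

lemma shift_nth [simp]: "shift k i t q j $ l = (if (j, l) = (k, i) then q j $ l + t else q j $ l)"
  by (auto simp: shift_def axis_def)

lemma trest_shift [simp]: "trest N (k, i) F (shift k i t q) = trest N (k, i) F q"
  unfolding trest_def by (rule prod.cong) (auto split: prod.split)

lemma tprod_shift:
  "k < N \<Longrightarrow> tprod N F (shift k i t q) = F (k, i) (q k $ i + t) * trest N (k, i) F q"
  by (simp add: tprod_split[of k N F _ i])

lemma tprod_upd: "k < N \<Longrightarrow> tprod N (F((k, i) := f)) q = f (q k $ i) * trest N (k, i) F q"
  by (simp add: tprod_split[of k N _ _ i])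

lemma tprod_has_deriv:
  assumes k: "k < N" and F: "\<And>p. smooth (F p)"
  shows "((\<lambda>t. tprod N F (shift k i t q)) has_real_derivative
    tprod N (F((k, i) := deriv (F (k, i)))) q) (at 0)"
proof -
  have "((\<lambda>t. F (k, i) (q k $ i + t)) has_real_derivative deriv (F (k, i)) (q k $ i) * 1) (at 0)"
    by (rule DERIV_chain2[where f="F (k, i)"])
      (auto intro!: derivative_eq_intros simp: smooth_has_deriv(1)[OF F])
  then show ?thesis unfolding tprod_shift[OF k] tprod_upd[OF k]
    by (auto intro!: derivative_eq_intros)
qed

lemma partial_deriv_tprod:
  assumes k: "k < N" and F: "\<And>p. smooth (F p)"
  shows "partial_deriv k i (tprod N F) = tprod N (F((k, i) := deriv (F (k, i))))"
  using DERIV_imp_deriv[OF tprod_has_deriv[OF k F]]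
  by (auto simp: partial_deriv_def shift_def fun_eq_iff)

lemma continuous_on_coord: "continuous_on S (\<lambda>q::config. q k $ i)"
  by (intro bounded_linear.continuous_on[OF bounded_linear_vec_nth] continuous_on_subset[OF continuous_on_product_coordinates]) auto

lemma continuous_on_tprod:
  assumes "\<And>p. smooth (F p)"
  shows "continuous_on S (tprod N F)"
  unfolding tprod_def
  by (intro continuous_on_prod continuous_on_compose2[OF smooth_continuous[OF assms] continuous_on_coord]) auto

text \<open>A partial derivative only replaces one factor by its derivative, so the class of
  products of smooth factors is closed under differentiation and the induction never leaves
  it.\<close>

lemma cont_diff_tprod:
  assumes "\<And>p. smooth (F p)"
  shows "cont_diff N n (tprod N F)"
  using assms
proof (induction n arbitrary: F)
  case 0
  then show ?case by (simp add: continuous_on_tprod)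
next
  case (Suc n)
  show ?case unfolding cont_diff.simps
  proof (intro conjI allI impI ballI)
    show "continuous_on (space (config_space N)) (tprod N F)"
      using Suc.prems by (rule continuous_on_tprod)
    fix k :: nat and i :: 3 assume k: "k < N"
    show "(\<lambda>t. tprod N F (q(k := q k + t *\<^sub>R axis i 1))) field_differentiable (at 0)" for q
      using tprod_has_deriv[OF k, of F i q] Suc.prems
      unfolding field_differentiable_def shift_def by blast
    show "cont_diff N n (partial_deriv k i (tprod N F))"
      unfolding partial_deriv_tprod[of k N F, OF k Suc.prems]
      by (rule Suc.IH) (auto simp: Suc.prems smooth_has_deriv(2))
  qed
qed

definition cube :: "nat \<Rightarrow> real \<Rightarrow> config set" where
  "cube N R = {q \<in> space (config_space N). \<forall>k<N. \<forall>i. \<bar>q k $ i\<bar> \<le> R}"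

lemma cube_eq: "cube N R = Pi\<^sub>E {..<N} (\<lambda>_. {x. \<forall>i. \<bar>x $ i\<bar> \<le> R})"
  unfolding cube_def space_config_space by (rule set_eqI) (simp add: PiE_iff Ball_def conj_commute)

text \<open>Tychonoff in the full function space \<open>config\<close>: the coordinates from
  \<open>N\<close> on range over the singleton \<open>{undefined}\<close>.\<close>

lemma compact_cube: "compact (cube N R)"
proof -
  have box: "{x::real^3. \<forall>i. \<bar>x $ i\<bar> \<le> R} = cbox (\<chi> i. - R) (\<chi> i. R)"
    by (auto simp: mem_box_cart abs_le_iff minus_le_iff)
  have "cube N R = Pi\<^sub>E UNIV (\<lambda>k. if k < N then {x. \<forall>i. \<bar>x $ i\<bar> \<le> R} else {undefined})"
    by (rule set_eqI) (simp add: cube_def space_config_space PiE_iff extensional_def, metis)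
  moreover have "compactin (product_topology (\<lambda>i. euclidean) UNIV) \<dots>"
    unfolding compactin_PiE by (auto simp: box)
  ultimately show ?thesis by (simp add: euclidean_product_topology)
qed

definition testfam :: "(nat \<times> 3 \<Rightarrow> real \<Rightarrow> real) \<Rightarrow> bool" where
  "testfam F \<longleftrightarrow> (\<forall>p. smooth (F p)) \<and> (\<exists>R. \<forall>p x. R < \<bar>x\<bar> \<longrightarrow> F p x = 0)"

lemma tprod_test_functions:
  assumes "testfam F"
  shows "tprod N F \<in> test_functions N"
proof -
  obtain R where R: "\<And>p x. R < \<bar>x\<bar> \<Longrightarrow> F p x = 0" using assms by (auto simp: testfam_def)
  have "tprod N F q = 0" if q: "q \<in> space (config_space N) - cube N R" for q
  proof -
    obtain k i where ki: "k < N" "R < \<bar>q k $ i\<bar>" using q by (auto simp: cube_def not_le)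
    then show ?thesis using R by (simp add: tprod_split[of k N F q i])
  qed
  moreover have "cube N R \<subseteq> space (config_space N)" by (auto simp: cube_def)
  ultimately show ?thesis
    using assms compact_cube[of N R] by (auto simp: test_functions_def testfam_def intro!: cont_diff_tprod)
qed

section \<open>The fundamental lemma of the calculus of variations\<close>

text \<open>Continuity refers to the topology of all functions on \<open>nat\<close>, measurability
  to a finite product. The identity from \<open>config_space N\<close> to the Borel space on
  \<open>config\<close> is measurable coordinatewise, since the coordinates from \<open>N\<close> on
  are constant.\<close>

lemma measurable_continuous_on_config_space:
  assumes "continuous_on (space (config_space N)) \<phi>"
  shows "\<phi> \<in> borel_measurable (config_space N)"
proof -
  have c: "(\<lambda>q. q) \<in> config_space N \<rightarrow>\<^sub>M (borel :: config measure)"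
  proof (rule measurable_coordinatewise_then_product)
    fix k show "(\<lambda>q. q k) \<in> borel_measurable (config_space N)"
    proof (cases "k < N")
      case False
      have "(\<lambda>q. q k) \<in> borel_measurable (config_space N) \<longleftrightarrow>
          (\<lambda>q. undefined::real^3) \<in> borel_measurable (config_space N)"
        by (rule measurable_cong) (use False in \<open>auto simp: space_config_space PiE_iff extensional_def\<close>)
      then show ?thesis by simp
    qed measurable
  qed
  have "(\<lambda>q. q) \<in> config_space N \<rightarrow>\<^sub>M restrict_space borel (space (config_space N))"
    by (rule measurable_restrict_space2[OF _ c]) simp
  from measurable_compose[OF this borel_measurable_continuous_on_restrict[OF assms]]
  show ?thesis .
qed

lemma sets_cube [measurable]: "cube N R \<in> sets (config_space N)"
proof -
  have "{x::real^3. \<forall>i. \<bar>x $ i\<bar> \<le> R} = cbox (\<chi> i. - R) (\<chi> i. R)"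
    by (auto simp: mem_box_cart abs_le_iff minus_le_iff)
  then show ?thesis unfolding cube_eq by (intro sets_config_spaceI) simp
qed

lemma emeasure_cube: "emeasure (config_space N) (cube N R) < \<infinity>"
proof -
  have "{x::real^3. \<forall>i. \<bar>x $ i\<bar> \<le> R} = cbox (\<chi> i. - R) (\<chi> i. R)"
    by (auto simp: mem_box_cart abs_le_iff minus_le_iff)
  then show ?thesis unfolding cube_eq
    by (subst emeasure_config_space) (simp_all add: power_less_top_ennreal emeasure_lborel_cbox_finite[unfolded infinity_ennreal_def])
qed

section \<open>Local integrability, tested on cubes\<close>

definition loc_int :: "nat \<Rightarrow> (config \<Rightarrow> real) \<Rightarrow> bool" where
  "loc_int N f \<longleftrightarrow> f \<in> borel_measurable (config_space N) \<and>
    (\<forall>R. integrable (config_space N) (\<lambda>q. indicator (cube N R) q * f q))"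

lemma integrable_cube: "integrable (config_space N) (\<lambda>q. indicator (cube N R) q :: real)"
  using emeasure_cube[of N R] by (simp add: integrable_indicator_iff)

lemma loc_int_L2:
  assumes [measurable]: "f \<in> borel_measurable (config_space N)" and "integrable (config_space N) (\<lambda>q. (f q)\<^sup>2)"
  shows "loc_int N f"
  unfolding loc_int_def
proof (intro conjI allI assms(1))
  fix R
  have "integrable (config_space N) (\<lambda>q. indicator (cube N R) q + (f q)\<^sup>2)"
    by (intro Bochner_Integration.integrable_add integrable_cube assms(2))
  then show "integrable (config_space N) (\<lambda>q. indicator (cube N R) q * f q)"
  proof (rule Bochner_Integration.integrable_bound)
    have "\<bar>x\<bar> \<le> 1 + x\<^sup>2" for x :: real
      using sum_squares_bound[of "\<bar>x\<bar>" 1] by (simp add: power2_eq_square)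
    then show "AE q in config_space N. norm (indicator (cube N R) q * f q) \<le> norm (indicator (cube N R) q + (f q)\<^sup>2)"
      by (auto simp: indicator_def)
  qed measurable
qed

lemma loc_int_integrable:
  assumes f: "loc_int N f" and [measurable]: "\<phi> \<in> borel_measurable (config_space N)"
    and b: "\<And>q. q \<in> space (config_space N) \<Longrightarrow> \<bar>\<phi> q\<bar> \<le> B * indicator (cube N R) q"
  shows "integrable (config_space N) (\<lambda>q. \<phi> q * f q)"
proof -
  have [measurable]: "f \<in> borel_measurable (config_space N)" using f by (simp add: loc_int_def)
  have "integrable (config_space N) (\<lambda>q. B * (indicator (cube N R) q * f q))"
    using f by (auto simp: loc_int_def)
  then show ?thesis
  proof (rule Bochner_Integration.integrable_bound)
    show "AE q in config_space N. norm (\<phi> q * f q) \<le> norm (B * (indicator (cube N R) q * f q))"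
    proof (rule AE_I2)
      fix q assume "q \<in> space (config_space N)"
      then show "norm (\<phi> q * f q) \<le> norm (B * (indicator (cube N R) q * f q))"
        using mult_right_mono[OF order_trans[OF b abs_ge_self], of q "\<bar>f q\<bar>"]
        by (simp add: abs_mult mult.assoc)
    qed
  qed measurable
qed

section \<open>Open boxes: limits of test functions and generators of the measurable sets\<close>

definition obox :: "nat \<Rightarrow> (nat \<times> 3 \<Rightarrow> real) \<Rightarrow> (nat \<times> 3 \<Rightarrow> real) \<Rightarrow> config set" where
  "obox N a b = {q \<in> space (config_space N). \<forall>p\<in>{..<N} \<times> UNIV. a p < q (fst p) $ snd p \<and> q (fst p) $ snd p < b p}"

lemma testfam_bump:
  assumes "\<And>p. - R \<le> a p" "\<And>p. b p \<le> R" "0 < c"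
  shows "testfam (\<lambda>p. bump c (a p) (b p))"
proof -
  have "bump c (a p) (b p) x = 0" if "R < \<bar>x\<bar>" for p x
    using assms(1,2)[of p] that by (intro bump_outside) auto
  then show ?thesis using assms(3) by (auto simp: testfam_def smooth_bump intro!: exI[of _ R])
qed

text \<open>Products of bumps converge pointwise to the indicator of the box as their parameter
  tends to 0. They are bounded by 1 and supported in one cube, so dominated convergence carries the
  vanishing integrals to the limit.\<close>

lemma integral_obox_eq_0:
  assumes f: "loc_int N f"
    and z: "\<And>F. testfam F \<Longrightarrow> (LINT q|config_space N. f q * tprod N F q) = 0"
    and ab: "\<And>p. - R \<le> a p" "\<And>p. b p \<le> R"
  shows "(LINT q|config_space N. indicator (obox N a b) q * f q) = 0"
proof -
  let ?F = "\<lambda>n p. bump (1 / real (Suc n)) (a p) (b p)"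
  have tf: "testfam (?F n)" for n by (rule testfam_bump[OF ab]) simp
  have [measurable]: "f \<in> borel_measurable (config_space N)" using f by (simp add: loc_int_def)
  have tm[measurable]: "tprod N (?F n) \<in> borel_measurable (config_space N)" for n
    using tf[of n] unfolding testfam_def by (intro measurable_continuous_on_config_space continuous_on_tprod) blast
  have lim: "(\<lambda>n. tprod N (?F n) q) \<longlonglongrightarrow> indicator (obox N a b) q" if qs: "q \<in> space (config_space N)" for q
  proof -
    have "(\<lambda>n. tprod N (?F n) q) \<longlonglongrightarrow> (\<Prod>p\<in>{..<N} \<times> UNIV. indicator {a p<..<b p} (q (fst p) $ snd p))"
      unfolding tprod_def by (intro tendsto_prod bump_tendsto)
    moreover have "(\<Prod>p\<in>{..<N} \<times> UNIV. indicator {a p<..<b p} (q (fst p) $ snd p)) = (indicator (obox N a b) q :: real)"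
    proof (cases "q \<in> obox N a b")
      case True
      then show ?thesis by (auto simp: obox_def indicator_def intro!: prod.neutral)
    next
      case False
      then obtain p where p: "p \<in> {..<N} \<times> UNIV" "\<not> (a p < q (fst p) $ snd p \<and> q (fst p) $ snd p < b p)"
        using qs unfolding obox_def by blast
      then have "indicator {a p<..<b p} (q (fst p) $ snd p) = (0::real)" by (simp add: indicator_def)
      with p(1) have "(\<Prod>p\<in>{..<N} \<times> UNIV. indicator {a p<..<b p} (q (fst p) $ snd p)) = (0::real)"
        by (intro prod_zero bexI[of _ p]) auto
      then show ?thesis using False by simp
    qed
    ultimately show ?thesis by simp
  qed
  \<comment> \<open>Measurability of the box is obtained here as that of a pointwise limit of
    continuous functions.\<close>
  have [measurable]: "(indicator (obox N a b) :: config \<Rightarrow> real) \<in> borel_measurable (config_space N)"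
    by (rule borel_measurable_LIMSEQ_real[OF lim tm])
  have bound: "\<bar>tprod N (?F n) q\<bar> \<le> indicator (cube N R) q" if q: "q \<in> space (config_space N)" for n q
  proof (cases "q \<in> cube N R")
    case True
    have "\<bar>tprod N (?F n) q\<bar> = (\<Prod>p\<in>{..<N} \<times> UNIV. \<bar>?F n p (q (fst p) $ snd p)\<bar>)"
      by (simp add: tprod_def abs_prod)
    also have "\<dots> \<le> 1" by (intro prod_le_1) (auto simp: bump_bounds)
    finally show ?thesis using True by simp
  next
    case False
    then obtain k i where ki: "k < N" "R < \<bar>q k $ i\<bar>" using q by (auto simp: cube_def not_le)
    have "?F n (k, i) (q k $ i) = 0"
      using ki ab[of "(k, i)"] by (intro bump_outside) auto
    then show ?thesis by (simp add: tprod_split[OF ki(1), of _ q i])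
  qed
  have "(\<lambda>n. LINT q|config_space N. f q * tprod N (?F n) q) \<longlonglongrightarrow> (LINT q|config_space N. f q * indicator (obox N a b) q)"
  proof (rule integral_dominated_convergence[where w="\<lambda>q. \<bar>indicator (cube N R) q * f q\<bar>"])
    show "integrable (config_space N) (\<lambda>q. \<bar>indicator (cube N R) q * f q\<bar>)"
      using f by (auto simp: loc_int_def)
    show "AE q in config_space N. (\<lambda>n. f q * tprod N (?F n) q) \<longlonglongrightarrow> f q * indicator (obox N a b) q"
      using lim by (auto intro!: tendsto_mult_left)
    show "AE q in config_space N. norm (f q * tprod N (?F n) q) \<le> \<bar>indicator (cube N R) q * f q\<bar>" for n
    proof (rule AE_I2)
      fix q assume "q \<in> space (config_space N)"
      from mult_right_mono[OF bound[OF this, of n], of "\<bar>f q\<bar>"]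
      show "norm (f q * tprod N (?F n) q) \<le> \<bar>indicator (cube N R) q * f q\<bar>"
        by (simp add: abs_mult mult.commute)
    qed
  qed measurable
  then show ?thesis unfolding z[OF tf] by (simp add: LIMSEQ_const_iff mult.commute)
qed

text \<open>The same sets as all \<open>obox N a b\<close>, written in the shape in which
  \<open>sets_PiM_sigma\<close> produces generators of a product.\<close>

definition oboxes :: "nat \<Rightarrow> config set set" where
  "oboxes N = {{q \<in> (\<Pi>\<^sub>E k\<in>{..<N}. UNIV). \<forall>k\<in>{..<N}. q k \<in> A k} | A. A \<in> {..<N} \<rightarrow> range (\<lambda>(a, b). box a b :: (real^3) set)}"

lemma oboxesE:
  assumes "X \<in> oboxes N"
  obtains a b where "X = obox N a b"
proof -
  obtain A where A: "A \<in> {..<N} \<rightarrow> range (\<lambda>(a, b). box a b :: (real^3) set)"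
    and X: "X = {q \<in> (\<Pi>\<^sub>E k\<in>{..<N}. UNIV). \<forall>k\<in>{..<N}. q k \<in> A k}"
    using assms by (auto simp: oboxes_def)
  have "\<forall>k. \<exists>u v. k < N \<longrightarrow> A k = box u v" using A by fastforce
  then obtain u v where uv: "\<And>k. k < N \<Longrightarrow> A k = box (u k) (v k)" by metis
  have "X = obox N (\<lambda>p. u (fst p) $ snd p) (\<lambda>p. v (fst p) $ snd p)"
    unfolding X obox_def by (auto simp: uv mem_box_cart space_config_space)
  then show ?thesis by (rule that)
qed

lemma oboxI: "obox N a b \<in> oboxes N"
proof -
  have "obox N a b = {q \<in> (\<Pi>\<^sub>E k\<in>{..<N}. UNIV). \<forall>k\<in>{..<N}. q k \<in> box (\<chi> i. a (k, i)) (\<chi> i. b (k, i))}"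
    by (auto simp: obox_def space_config_space mem_box_cart)
  moreover have "(\<lambda>k. box (\<chi> i. a (k, i)) (\<chi> i. b (k, i))) \<in> {..<N} \<rightarrow> range (\<lambda>(a, b). box a b :: (real^3) set)"
  proof (rule Pi_I)
    fix k
    have "box (\<chi> i. a (k, i)) (\<chi> i. b (k, i)) = (\<lambda>(a, b). box a b :: (real^3) set) (\<chi> i. a (k, i), \<chi> i. b (k, i))"
      by simp
    then show "box (\<chi> i. a (k, i)) (\<chi> i. b (k, i)) \<in> range (\<lambda>(a, b). box a b :: (real^3) set)"
      by (rule range_eqI)
  qed
  ultimately show ?thesis unfolding oboxes_def mem_Collect_eq
    by (intro exI[of _ "\<lambda>k. box (\<chi> i. a (k, i)) (\<chi> i. b (k, i))"] conjI)
qed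

lemma obox_Int: "obox N a b \<inter> obox N c d = obox N (\<lambda>p. max (a p) (c p)) (\<lambda>p. min (b p) (d p))"
  by (auto simp: obox_def)

text \<open>Open boxes generate the Borel sets of \<open>real^3\<close>, and countably many of them
  cover it; the second fact is what lets generators of the factors generate the product.\<close>

lemma sets_config_space_oboxes: "sets (config_space N) = sigma_sets (space (config_space N)) (oboxes N)"
proof -
  let ?E = "range (\<lambda>(a, b). box a b :: (real^3) set)"
  have b: "(borel :: (real^3) measure) = sigma UNIV ?E" by (rule borel_eq_box)
  have "sets (config_space N) = sets (\<Pi>\<^sub>M k\<in>{..<N}. borel :: (real^3) measure)"
    unfolding config_space_def by (rule sets_PiM_cong) auto
  also have "\<dots> = sets (\<Pi>\<^sub>M k\<in>{..<N}. sigma UNIV ?E)" by (simp add: b[symmetric])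
  also have "\<dots> = sets (sigma (\<Pi>\<^sub>E k\<in>{..<N}. UNIV) {{f \<in> (\<Pi>\<^sub>E i\<in>{..<N}. UNIV). \<forall>i\<in>j. f i \<in> A i} | A j. j \<in> {{..<N}} \<and> A \<in> Pi j (\<lambda>_. ?E)})"
  proof (rule sets_PiM_sigma)
    have "\<exists>n::nat. \<forall>i. - real n < x $ i \<and> x $ i < real n" for x :: "real^3"
    proof -
      obtain n :: nat where "norm x < real n" using reals_Archimedean2 by blast
      then have "\<bar>x $ i\<bar> < real n" for i using component_le_norm_cart[of x i] by linarith
      then show ?thesis by (intro exI[of _ n]) (simp add: abs_less_iff minus_less_iff)
    qed
    then have "(UNIV :: (real^3) set) = (\<Union>n::nat. box (\<chi> i. - real n) (\<chi> i. real n))"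
      by (auto simp: mem_box_cart)
    then show "\<exists>S\<subseteq>?E. countable S \<and> UNIV = \<Union>S"
      by (intro exI[of _ "range (\<lambda>n::nat. box (\<chi> i. - real n) (\<chi> i. real n))"]) auto
  qed auto
  also have "{{f \<in> (\<Pi>\<^sub>E i\<in>{..<N}. UNIV). \<forall>i\<in>j. f i \<in> A i} | A j. j \<in> {{..<N}} \<and> A \<in> Pi j (\<lambda>_. ?E)} = oboxes N"
    by (auto simp: oboxes_def)
  also have "sets (sigma (\<Pi>\<^sub>E k\<in>{..<N}. UNIV) (oboxes N)) = sigma_sets (space (config_space N)) (oboxes N)"
    unfolding space_config_space by (rule sets_measure_of) (auto simp: oboxes_def)
  finally show ?thesis .
qed

lemma in_obox_cube:
  assumes "q \<in> space (config_space N)"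
  shows "\<exists>n. q \<in> obox N (\<lambda>_. - real n) (\<lambda>_. real n)"
proof -
  have "finite ((\<lambda>p. \<bar>q (fst p) $ snd p\<bar>) ` ({..<N} \<times> UNIV))" by simp
  from bdd_above_finite[OF this] obtain B where
    "\<forall>x\<in>(\<lambda>p. \<bar>q (fst p) $ snd p\<bar>) ` ({..<N} \<times> UNIV). x \<le> B" unfolding bdd_above_def by blast
  then have B: "\<And>p. p \<in> {..<N} \<times> UNIV \<Longrightarrow> \<bar>q (fst p) $ snd p\<bar> \<le> B" by blast
  obtain n :: nat where "B < real n" using reals_Archimedean2 by blast
  have "- real n < q (fst p) $ snd p \<and> q (fst p) $ snd p < real n" if "p \<in> {..<N} \<times> UNIV" for p
    using B[OF that] \<open>B < real n\<close> by linarith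
  then have "q \<in> obox N (\<lambda>_. - real n) (\<lambda>_. real n)"
    using assms unfolding obox_def by blast
  then show ?thesis ..
qed

lemma obox_subset_cube: "obox N (\<lambda>_. - R) (\<lambda>_. R) \<subseteq> cube N R"
proof
  fix q assume q: "q \<in> obox N (\<lambda>_. - R) (\<lambda>_. R)"
  have "\<bar>q k $ i\<bar> \<le> R" if "k < N" for k i
  proof -
    have "(k, i) \<in> {..<N} \<times> UNIV" using that by simp
    with q have "- R < q k $ i \<and> q k $ i < R" unfolding obox_def by fastforce
    then show ?thesis by linarith
  qed
  then show "q \<in> cube N R" using q by (simp add: obox_def cube_def)
qed

lemma sets_obox [measurable]: "obox N a b \<in> sets (config_space N)"
  unfolding sets_config_space_oboxes using oboxI by (rule sigma_sets.Basic)

text \<open>No mollification of \<open>f\<close> is involved. Since \<open>f\<close> is only locally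
  integrable, it is first cut off to a bounded box. The measurable sets over which the cut-off
  function has integral 0 form a Dynkin system containing the open boxes, which are stable under
  intersection; so all integrals vanish and with them the function.\<close>

lemma fundamental_lemma:
  assumes f: "loc_int N f"
    and z: "\<And>F. testfam F \<Longrightarrow> (LINT q|config_space N. f q * tprod N F q) = 0"
  shows "AE q in config_space N. f q = 0"
proof -
  have [measurable]: "f \<in> borel_measurable (config_space N)" using f by (simp add: loc_int_def)
  have "AE q in config_space N. indicator (obox N (\<lambda>_. - real n) (\<lambda>_. real n)) q * f q = 0" for n
  proof (rule density_unique_real)
    let ?B = "obox N (\<lambda>_. - real n) (\<lambda>_. real n)"
    let ?f = "\<lambda>q. indicator ?B q * f q"
    show int: "integrable (config_space N) ?f"
    proof (rule loc_int_integrable[OF f])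
      show "\<bar>indicator ?B q\<bar> \<le> 1 * (indicator (cube N (real n)) q :: real)" for q
        using obox_subset_cube[of N "real n"] by (auto simp: indicator_def)
    qed measurable
    fix A assume A: "A \<in> sets (config_space N)"
    have "(LINT q:A|config_space N. ?f q) = 0"
    proof (rule sigma_sets_induct_disjoint[where P="\<lambda>A. (LINT q:A|config_space N. ?f q) = 0" and \<Omega>="space (config_space N)" and G="oboxes N"])
      show "Int_stable (oboxes N)"
        by (auto simp: Int_stable_def obox_Int oboxI elim!: oboxesE)
      show "oboxes N \<subseteq> Pow (space (config_space N))" by (auto simp: oboxes_def space_config_space)
      show "A \<in> sigma_sets (space (config_space N)) (oboxes N)"
        using A by (simp add: sets_config_space_oboxes)
      show "(LINT q:{}|config_space N. ?f q) = 0" by (simp add: set_lebesgue_integral_def)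
      {
        fix X assume "X \<in> oboxes N"
        then obtain a b where X: "X = obox N a b" by (rule oboxesE)
        have "(LINT q|config_space N. indicator (obox N (\<lambda>p. max (a p) (- real n)) (\<lambda>p. min (b p) (real n))) q * f q) = 0"
          by (rule integral_obox_eq_0[OF f z, where R="real n"]) auto
        then show "(LINT q:X|config_space N. ?f q) = 0"
          unfolding X set_lebesgue_integral_def obox_Int[symmetric]
          by (simp add: indicator_inter_arith mult.assoc)
      } note basic = this
      \<comment> \<open>The integral over the whole space, from which complements are subtracted in
        the Dynkin argument.\<close>
      have whole: "(LINT q|config_space N. ?f q) = 0"
        by (rule integral_obox_eq_0[OF f z, where R="real n"]) auto
      {
        fix X assume X: "X \<in> sigma_sets (space (config_space N)) (oboxes N)" and 0: "(LINT q:X|config_space N. ?f q) = 0"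
        have [measurable]: "X \<in> sets (config_space N)" using X by (simp add: sets_config_space_oboxes)
        have "(LINT q:space (config_space N) - X|config_space N. ?f q) = (LINT q|config_space N. ?f q - indicator X q * ?f q)"
          unfolding set_lebesgue_integral_def
          by (rule Bochner_Integration.integral_cong) (auto simp: indicator_def)
        also have "\<dots> = (LINT q|config_space N. ?f q) - (LINT q|config_space N. indicator X q * ?f q)"
          using int integrable_mult_indicator[OF \<open>X \<in> sets (config_space N)\<close> int]
          by (intro Bochner_Integration.integral_diff) auto
        finally show "(LINT q:space (config_space N) - X|config_space N. ?f q) = 0"
          using 0 whole by (simp add: set_lebesgue_integral_def)
      }
      {
        fix X :: "nat \<Rightarrow> config set" assume d: "disjoint_family X"
          and X: "range X \<subseteq> sigma_sets (space (config_space N)) (oboxes N)"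
          and 0: "\<And>i. (LINT q:X i|config_space N. ?f q) = 0"
        have [measurable]: "X i \<in> sets (config_space N)" for i using X by (auto simp: sets_config_space_oboxes)
        have "(LINT q:(\<Union>i. X i)|config_space N. ?f q) = (\<Sum>i. (LINT q:X i|config_space N. ?f q))"
        proof (rule lebesgue_integral_countable_add)
          show "set_integrable (config_space N) (\<Union>i. X i) ?f"
            unfolding set_integrable_def by (intro integrable_mult_indicator int) measurable
        qed (use d in \<open>auto simp: disjoint_family_on_def\<close>)
        then show "(LINT q:(\<Union>i. X i)|config_space N. ?f q) = 0" using 0 by simp
      }
    qed
    then show "(LINT q:A|config_space N. ?f q) = (LINT q:A|config_space N. 0)"
      by (simp add: set_lebesgue_integral_def)
  qed simp
  then have "AE q in config_space N. \<forall>n. indicator (obox N (\<lambda>_. - real n) (\<lambda>_. real n)) q * f q = 0"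
    unfolding AE_all_countable by blast
  then show ?thesis
  proof (rule AE_mp, intro AE_I2 impI)
    fix q assume "q \<in> space (config_space N)" and *: "\<forall>n. indicator (obox N (\<lambda>_. - real n) (\<lambda>_. real n)) q * f q = 0"
    then obtain n where "q \<in> obox N (\<lambda>_. - real n) (\<lambda>_. real n)" using in_obox_cube by blast
    with *[rule_format, of n] show "f q = 0" by simp
  qed
qed

section \<open>Weak derivatives as translation identities\<close>

lemma testfam_smooth: "testfam F \<Longrightarrow> smooth (F p)"
  unfolding testfam_def by blast

lemma ex_antiderivative:
  fixes u :: "real \<Rightarrow> real"
  assumes "continuous_on UNIV u"
  obtains S where "\<And>x. (S has_real_derivative u x) (at x)"
    and "\<And>a b. a \<le> b \<Longrightarrow> (LINT t|lborel. indicator {a..b} t * u t) = S b - S a"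
proof -
  have c: "isCont u x" for x using assms continuous_on_eq_continuous_at[of UNIV u] by simp
  have "\<exists>S. \<forall>x::real. - \<infinity> < ereal x \<longrightarrow> ereal x < \<infinity> \<longrightarrow> (S has_vector_derivative u x) (at x)"
    by (rule einterval_antiderivative) (auto simp: c)
  then obtain S where S: "\<And>x. (S has_real_derivative u x) (at x)"
    by (auto simp: has_real_derivative_iff_has_vector_derivative)
  have "(LINT t|lborel. indicator {a..b} t * u t) = S b - S a" if "a \<le> b" for a b
    using integral_FTC_Icc_real[OF that, of S u] S c by (simp add: mult.commute)
  with S that show ?thesis by blast
qed

lemma cube_shift:
  assumes "k < N" "shift k i t q \<in> cube N R" "q \<in> space (config_space N)" "\<bar>t\<bar> \<le> h"
  shows "q \<in> cube N (R + h)"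
proof -
  have "\<bar>q j $ l\<bar> \<le> R + h" if "j < N" for j l
  proof -
    have "\<bar>shift k i t q j $ l\<bar> \<le> R" using assms(2) that by (simp add: cube_def)
    then show ?thesis using assms(4) by (auto split: if_splits)
  qed
  then show ?thesis using assms(3) by (simp add: cube_def)
qed

lemma indicator_cube_shift:
  assumes "k < N" "q \<in> space (config_space N)" "\<bar>t\<bar> \<le> h"
  shows "indicator (cube N R) (shift k i t q) \<le> (indicator (cube N (R + h)) q :: real)"
  using cube_shift[OF assms(1) _ assms(2,3)] by (auto simp: indicator_def)

text \<open>A Bochner integral, hence 0 on a segment along which \<open>G\<close> is not
  integrable.\<close>

definition line_int :: "nat \<Rightarrow> 3 \<Rightarrow> real \<Rightarrow> (config \<Rightarrow> real) \<Rightarrow> config \<Rightarrow> real" where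
  "line_int k i h G q = (LINT t|lborel. indicator {0..h} t * G (shift k i t q))"

text \<open>The step \<open>h\<close> is fixed outside the quantifier, so the exceptional null set
  may depend on it; for this reason later arguments collect only countably many steps.\<close>

definition translates :: "nat \<Rightarrow> nat \<Rightarrow> 3 \<Rightarrow> (config \<Rightarrow> real) \<Rightarrow> (config \<Rightarrow> real) \<Rightarrow> real \<Rightarrow> bool" where
  "translates N k i \<psi> G h \<longleftrightarrow>
    (AE q in config_space N. \<psi> (shift k i h q) - \<psi> q = line_int k i h G q)"

lemma measurable_line_int [measurable]:
  assumes [measurable]: "k < N" "G \<in> borel_measurable (config_space N)"
  shows "line_int k i h G \<in> borel_measurable (config_space N)"
  unfolding line_int_def[abs_def] by measurable

section \<open>Line integrals tested against bounded weights of bounded support\<close>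

context
  fixes N k :: nat and i :: 3 and h B R :: real and G \<phi> :: "config \<Rightarrow> real"
  assumes k [measurable]: "k < N" and h: "0 \<le> h" and G: "loc_int N G"
    and \<phi> [measurable]: "\<phi> \<in> borel_measurable (config_space N)"
    and B: "0 \<le> B" "\<And>q. q \<in> space (config_space N) \<Longrightarrow> \<bar>\<phi> q\<bar> \<le> B * indicator (cube N R) q"
begin

private lemma Gm [measurable]: "G \<in> borel_measurable (config_space N)"
  using G by (simp add: loc_int_def)

lemma shift_bound:
  assumes "q \<in> space (config_space N)" "\<bar>t\<bar> \<le> h"
  shows "\<bar>\<phi> (shift k i t q)\<bar> \<le> B * indicator (cube N (R + h)) q"
proof -
  have "\<bar>\<phi> (shift k i t q)\<bar> \<le> B * indicator (cube N R) (shift k i t q)"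
    using assms k by (intro B) auto
  also have "\<dots> \<le> B * indicator (cube N (R + h)) q"
    using assms k B(1) by (intro mult_left_mono indicator_cube_shift) auto
  finally show ?thesis .
qed

text \<open>For \<open>t\<close> in \<open>{0..h}\<close> the translated weight stays below
  \<open>B\<close> times the indicator of one enlarged cube, so the double integral is at most
  \<open>h\<close> times a local integral of \<open>G\<close>.\<close>

lemma integrable_shifted_weight:
  "integrable (config_space N \<Otimes>\<^sub>M lborel) (\<lambda>(q, t). indicator {0..h} t * (\<phi> (shift k i (- t) q) * G q))"
proof (rule integrableI_bounded)
  let ?g = "\<lambda>q. B * \<bar>indicator (cube N (R + h)) q * G q\<bar>"
  have g: "integrable (config_space N) ?g" using G by (auto simp: loc_int_def)
  have "(\<integral>\<^sup>+x. ennreal (norm (case x of (q, t) \<Rightarrow> indicator {0..h} t * (\<phi> (shift k i (- t) q) * G q))) \<partial>(config_space N \<Otimes>\<^sub>M lborel))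
      \<le> (\<integral>\<^sup>+x. ennreal (?g (fst x)) * indicator {0..h} (snd x) \<partial>(config_space N \<Otimes>\<^sub>M lborel))"
  proof (rule nn_integral_mono)
    fix x assume "x \<in> space (config_space N \<Otimes>\<^sub>M (lborel :: real measure))"
    then obtain q t where x: "x = (q, t)" and q: "q \<in> space (config_space N)"
      by (cases x) (auto simp: space_pair_measure)
    show "ennreal (norm (case x of (q, t) \<Rightarrow> indicator {0..h} t * (\<phi> (shift k i (- t) q) * G q)))
      \<le> ennreal (?g (fst x)) * indicator {0..h} (snd x)"
    proof (cases "t \<in> {0..h}")
      case True
      have "\<bar>\<phi> (shift k i (- t) q)\<bar> * \<bar>G q\<bar> \<le> B * indicator (cube N (R + h)) q * \<bar>G q\<bar>"
        using True q by (intro mult_right_mono shift_bound) auto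
      then show ?thesis using True x by (simp add: abs_mult ennreal_leI mult.assoc)
    qed (simp add: x)
  qed
  also have "\<dots> = (\<integral>\<^sup>+q. \<integral>\<^sup>+t. ennreal (?g q) * indicator {0..h} t \<partial>lborel \<partial>config_space N)"
    by (subst lborel.nn_integral_fst[symmetric]) simp_all
  also have "\<dots> = (\<integral>\<^sup>+q. ennreal (?g q) * ennreal h \<partial>config_space N)"
    using h by (intro nn_integral_cong) (simp add: nn_integral_cmult)
  also have "\<dots> = (\<integral>\<^sup>+q. ennreal (?g q) \<partial>config_space N) * ennreal h"
    by (rule nn_integral_multc) measurable
  also have "\<dots> < \<infinity>"
    using g B(1) by (subst nn_integral_eq_integral) (auto simp: ennreal_mult_less_top)
  finally show "(\<integral>\<^sup>+x. ennreal (norm (case x of (q, t) \<Rightarrow> indicator {0..h} t * (\<phi> (shift k i (- t) q) * G q))) \<partial>(config_space N \<Otimes>\<^sub>M lborel)) < \<infinity>" .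
qed measurable

text \<open>For each fixed \<open>t\<close>, translating \<open>q\<close> turns this integrand into
  that of \<open>integrable_shifted_weight\<close>, so both have the same absolute integral.\<close>

lemma integrable_weight_shifted:
  "integrable (config_space N \<Otimes>\<^sub>M lborel) (\<lambda>(q, t). indicator {0..h} t * (\<phi> q * G (shift k i t q)))"
proof (rule integrableI_bounded)
  have "(\<integral>\<^sup>+x. ennreal (norm (case x of (q, t) \<Rightarrow> indicator {0..h} t * (\<phi> q * G (shift k i t q)))) \<partial>(config_space N \<Otimes>\<^sub>M lborel))
    = (\<integral>\<^sup>+t. \<integral>\<^sup>+q. ennreal (norm (indicator {0..h} t * (\<phi> q * G (shift k i t q)))) \<partial>config_space N \<partial>lborel)"
    by (subst csl.nn_integral_snd[symmetric]) simp_all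
  also have "\<dots> = (\<integral>\<^sup>+t. \<integral>\<^sup>+q. ennreal (norm (indicator {0..h} t * (\<phi> (shift k i (- t) q) * G q))) \<partial>config_space N \<partial>lborel)"
  proof (rule nn_integral_cong)
    fix t
    show "(\<integral>\<^sup>+q. ennreal (norm (indicator {0..h} t * (\<phi> q * G (shift k i t q)))) \<partial>config_space N) =
        (\<integral>\<^sup>+q. ennreal (norm (indicator {0..h} t * (\<phi> (shift k i (- t) q) * G q))) \<partial>config_space N)"
      using nn_integral_preserving[OF distr_shift[OF k, of i "- t"] shift_measurable[OF k, of i "- t"],
          of "\<lambda>q. ennreal (norm (indicator {0..h} t * (\<phi> q * G (shift k i t q))))"] by simp
  qed
  also have "\<dots> = (\<integral>\<^sup>+x. ennreal (norm (case x of (q, t) \<Rightarrow> indicator {0..h} t * (\<phi> (shift k i (- t) q) * G q))) \<partial>(config_space N \<Otimes>\<^sub>M lborel))"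
    by (subst csl.nn_integral_snd[symmetric]) simp_all
  also have "\<dots> < \<infinity>" using integrable_shifted_weight by (simp add: integrable_iff_bounded)
  finally show "(\<integral>\<^sup>+x. ennreal (norm (case x of (q, t) \<Rightarrow> indicator {0..h} t * (\<phi> q * G (shift k i t q)))) \<partial>(config_space N \<Otimes>\<^sub>M lborel)) < \<infinity>" .
qed measurable

lemma integrable_mult_line_int: "integrable (config_space N) (\<lambda>q. \<phi> q * line_int k i h G q)"
proof -
  have "\<phi> q * line_int k i h G q = (LINT t|lborel. indicator {0..h} t * (\<phi> q * G (shift k i t q)))" for q
    unfolding line_int_def by (subst integral_mult_right_zero[symmetric]) (simp add: mult.left_commute)
  then show ?thesis using csl.integrable_fst'[OF integrable_weight_shifted] by simp
qed

text \<open>Averaging along a segment has as adjoint the averaging along the reversed segment: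
  Fubini, a translation for each \<open>t\<close>, and Fubini again.\<close>

lemma integral_mult_line_int:
  "(LINT q|config_space N. \<phi> q * line_int k i h G q) =
   (LINT q|config_space N. (LINT t|lborel. indicator {0..h} t * \<phi> (shift k i (- t) q)) * G q)"
proof -
  have "\<phi> q * line_int k i h G q = (LINT t|lborel. indicator {0..h} t * (\<phi> q * G (shift k i t q)))" for q
    unfolding line_int_def by (subst integral_mult_right_zero[symmetric]) (simp add: mult.left_commute)
  then have "(LINT q|config_space N. \<phi> q * line_int k i h G q) =
      (LINT q|config_space N. LINT t|lborel. indicator {0..h} t * (\<phi> q * G (shift k i t q)))" by simp
  also have "\<dots> = (LINT t|lborel. LINT q|config_space N. indicator {0..h} t * (\<phi> q * G (shift k i t q)))"
    using csl.Fubini_integral[OF integrable_weight_shifted] by simp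
  also have "\<dots> = (LINT t|lborel. LINT q|config_space N. indicator {0..h} t * (\<phi> (shift k i (- t) q) * G q))"
  proof (rule Bochner_Integration.integral_cong[OF refl])
    fix t
    show "(LINT q|config_space N. indicator {0..h} t * (\<phi> q * G (shift k i t q))) =
        (LINT q|config_space N. indicator {0..h} t * (\<phi> (shift k i (- t) q) * G q))"
      using integral_preserving[OF distr_shift[OF k, of i "- t"] shift_measurable[OF k, of i "- t"],
          of "\<lambda>q. indicator {0..h} t * (\<phi> q * G (shift k i t q))"] by auto
  qed
  also have "\<dots> = (LINT q|config_space N. LINT t|lborel. indicator {0..h} t * (\<phi> (shift k i (- t) q) * G q))"
    using csl.Fubini_integral[OF integrable_shifted_weight] by simp
  also have "\<dots> = (LINT q|config_space N. (LINT t|lborel. indicator {0..h} t * \<phi> (shift k i (- t) q)) * G q)"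
    by (intro Bochner_Integration.integral_cong refl)
       (subst integral_mult_left_zero[symmetric], simp add: mult.assoc)
  finally show ?thesis .
qed

end

lemma loc_int_shift:
  assumes k [measurable]: "k < N" and f: "loc_int N f"
  shows "loc_int N (\<lambda>q. f (shift k i h q))"
  unfolding loc_int_def
proof (intro conjI allI)
  have [measurable]: "f \<in> borel_measurable (config_space N)" using f by (simp add: loc_int_def)
  show "(\<lambda>q. f (shift k i h q)) \<in> borel_measurable (config_space N)" by measurable
  fix R
  have "integrable (config_space N) (\<lambda>q. indicator (cube N R) (shift k i (- h) q) * f q)"
  proof (rule loc_int_integrable[OF f])
    show "\<bar>indicator (cube N R) (shift k i (- h) q)\<bar> \<le> 1 * (indicator (cube N (R + \<bar>h\<bar>)) q :: real)"
      if "q \<in> space (config_space N)" for q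
      using indicator_cube_shift[OF k that, of "- h" "\<bar>h\<bar>" R i] by simp
  qed measurable
  from integrable_preserving[OF distr_shift[OF k, of i h] shift_measurable[OF k, of i h] this]
  show "integrable (config_space N) (\<lambda>q. indicator (cube N R) q * f (shift k i h q))" by simp
qed

lemma loc_int_diff: "loc_int N f \<Longrightarrow> loc_int N g \<Longrightarrow> loc_int N (\<lambda>q. f q - g q)"
  unfolding loc_int_def right_diff_distrib by auto

lemma loc_int_line_int:
  assumes k [measurable]: "k < N" and G: "loc_int N G" and h: "0 \<le> h"
  shows "loc_int N (line_int k i h G)"
proof -
  have [measurable]: "G \<in> borel_measurable (config_space N)" using G by (simp add: loc_int_def)
  show ?thesis unfolding loc_int_def
    using integrable_mult_line_int[OF k h G, of "indicator (cube N R)" 1 R i for R] by auto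
qed

lemma tprod_bound:
  assumes "testfam F"
  obtains B R where "0 \<le> B" "\<And>q. q \<in> space (config_space N) \<Longrightarrow> \<bar>tprod N F q\<bar> \<le> B * indicator (cube N R) q"
proof -
  obtain R where R: "\<And>p x. R < \<bar>x\<bar> \<Longrightarrow> F p x = 0" using assms by (auto simp: testfam_def)
  have 0: "tprod N F q = 0" if q: "q \<in> space (config_space N) - cube N R" for q
  proof -
    obtain k i where ki: "k < N" "R < \<bar>q k $ i\<bar>" using q by (auto simp: cube_def not_le)
    then show ?thesis using R by (simp add: tprod_split[of k N F q i])
  qed
  have "compact (tprod N F ` cube N R)"
    using assms by (intro compact_continuous_image compact_cube continuous_on_tprod testfam_smooth)
  then have "bounded (tprod N F ` cube N R)" by (rule compact_imp_bounded)
  then obtain B where B: "\<And>q. q \<in> cube N R \<Longrightarrow> \<bar>tprod N F q\<bar> \<le> B"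
    unfolding bounded_iff by auto
  show ?thesis
  proof (rule that[of "max 0 B" R])
    fix q assume "q \<in> space (config_space N)"
    then show "\<bar>tprod N F q\<bar> \<le> max 0 B * indicator (cube N R) q"
      using 0[of q] B[of q] by (cases "q \<in> cube N R") auto
  qed simp
qed

lemma smooth_diff: "smooth f \<Longrightarrow> smooth g \<Longrightarrow> smooth (\<lambda>x. f x - g x)"
  unfolding smooth_def
proof
  fix n assume "\<forall>n. cdiff n f" "\<forall>n. cdiff n g"
  then have "cdiff n (\<lambda>x. f x + (-1) * g x)" by (intro cdiff_add cdiff_mult cdiff_const) auto
  then show "cdiff n (\<lambda>x. f x - g x)" by simp
qed

lemma testfam_tprod_measurable:
  "testfam F \<Longrightarrow> tprod N F \<in> borel_measurable (config_space N)"
  unfolding testfam_def by (intro measurable_continuous_on_config_space continuous_on_tprod) blast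

text \<open>Averaging one factor along its axis stays within product test functions, and the partial derivative
  of the average is a difference of translates: testing the weak derivative against it yields the
  translation identity.\<close>

lemma testfam_averaged:
  fixes r :: "nat \<times> 3"
  assumes "testfam F" and h: "0 \<le> h"
  defines "b \<equiv> \<lambda>s. LINT t|lborel. indicator {0..h} t * F r (s - t)"
  shows "testfam (F(r := b))" and "deriv b = (\<lambda>s. F r s - F r (s - h))" and "smooth b"
proof -
  have sm: "smooth (F p)" for p using assms(1) by (rule testfam_smooth)
  obtain R where R: "\<And>p x. R < \<bar>x\<bar> \<Longrightarrow> F p x = 0" using assms by (auto simp: testfam_def)
  obtain S where S: "\<And>x. (S has_real_derivative F r x) (at x)"
    using ex_antiderivative[OF smooth_continuous[OF sm]] by metis
  have b: "b s = S s - S (s - h)" for s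
  proof -
    have "((\<lambda>t. - S (s - t)) has_real_derivative F r (s - t)) (at t)" for t
      by (auto intro!: derivative_eq_intros DERIV_chain2[OF S])
    moreover have "continuous_on UNIV (\<lambda>t. F r (s - t))"
      by (rule continuous_on_compose2[OF smooth_continuous[OF sm, of r]]) (auto intro: continuous_intros)
    then have "isCont (\<lambda>t. F r (s - t)) t" for t
      by (simp add: continuous_on_eq_continuous_at)
    ultimately show ?thesis
      using integral_FTC_Icc_real[OF h, of "\<lambda>t. - S (s - t)" "\<lambda>t. F r (s - t)"]
      by (simp add: b_def mult.commute)
  qed
  have D: "(b has_real_derivative F r s - F r (s - h)) (at s)" for s
    unfolding b[abs_def] by (auto intro!: derivative_eq_intros S DERIV_chain2[OF S])
  then show "deriv b = (\<lambda>s. F r s - F r (s - h))" by (auto intro!: DERIV_imp_deriv)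
  have "smooth (\<lambda>s. F r s - F r (s - h))"
    using smooth_diff[OF sm smooth_affine[OF sm, of r 1 "- h"], of r] by simp
  with D show sb: "smooth b" by (rule smoothI)
  \<comment> \<open>The support is read off the integral, because the antiderivative
    \<open>S\<close> by itself need not have compact support.\<close>
  have "b s = 0" if s: "R + h < \<bar>s\<bar>" for s
  proof -
    have "indicator {0..h} t * F r (s - t) = 0" for t
      using s R[of "s - t" r] by (cases "t \<in> {0..h}") auto
    then show ?thesis unfolding b_def by (simp only: Bochner_Integration.integral_zero)
  qed
  moreover have "F p x = 0" if "R + h < \<bar>x\<bar>" for p x using that h R[of x p] by simp
  ultimately show "testfam (F(r := b))"
    using sm sb by (auto simp: testfam_def intro!: exI[of _ "R + h"])
qed

lemma weak_deriv_imp_translates: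
  assumes k: "k < N" and \<psi>: "loc_int N \<psi>" and G: "loc_int N G" and h: "0 \<le> h"
    and w: "\<And>F. testfam F \<Longrightarrow> (LINT q|config_space N. \<psi> q * partial_deriv k i (tprod N F) q) =
      - (LINT q|config_space N. G q * tprod N F q)"
  shows "translates N k i \<psi> G h"
proof -
  let ?f = "\<lambda>q. \<psi> (shift k i h q) - \<psi> q - line_int k i h G q"
  note [measurable] = k
  have [measurable]: "\<psi> \<in> borel_measurable (config_space N)" "G \<in> borel_measurable (config_space N)"
    using \<psi> G by (simp_all add: loc_int_def)
  \<comment> \<open>The defect of the translation identity is locally integrable, so it is enough to
    test it against product functions, where the averaged factor \<open>b\<close> is
    available.\<close>
  have "AE q in config_space N. ?f q = 0"
  proof (rule fundamental_lemma)
    show "loc_int N ?f" by (intro loc_int_diff loc_int_shift loc_int_line_int k \<psi> G h)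
    fix F assume F: "testfam F"
    have [measurable]: "tprod N F \<in> borel_measurable (config_space N)" by (rule testfam_tprod_measurable[OF F])
    obtain B R where B: "0 \<le> B" "\<And>q. q \<in> space (config_space N) \<Longrightarrow> \<bar>tprod N F q\<bar> \<le> B * indicator (cube N R) q"
      using tprod_bound[OF F, of N] by blast
    define b where "b = (\<lambda>s. LINT t|lborel. indicator {0..h} t * F (k, i) (s - t))"
    note b = testfam_averaged[OF F h, of "(k, i)", folded b_def]
    have sm: "smooth ((F((k, i) := b)) p)" for p using b(1) by (rule testfam_smooth)
    have avg: "(LINT t|lborel. indicator {0..h} t * tprod N F (shift k i (- t) q)) = tprod N (F((k, i) := b)) q" for q
      unfolding tprod_shift[OF k] tprod_upd[OF k] b_def
      by (subst integral_mult_left_zero[symmetric]) (simp add: mult.assoc)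
    have i1: "integrable (config_space N) (\<lambda>q. tprod N F q * \<psi> (shift k i h q))"
      by (rule loc_int_integrable[OF loc_int_shift[OF k \<psi>] _ B(2)]) measurable
    have i2: "integrable (config_space N) (\<lambda>q. tprod N F q * \<psi> q)"
      by (rule loc_int_integrable[OF \<psi> _ B(2)]) measurable
    have i3: "integrable (config_space N) (\<lambda>q. tprod N F q * line_int k i h G q)"
      by (rule integrable_mult_line_int[OF k h G _ B]) measurable
    have tr: "(LINT q|config_space N. tprod N F q * \<psi> (shift k i h q)) =
        (LINT q|config_space N. tprod N F (shift k i (- h) q) * \<psi> q)"
      using integral_preserving[OF distr_shift[OF k, of i "- h"] shift_measurable[OF k, of i "- h"], of "\<lambda>q. tprod N F q * \<psi> (shift k i h q)"] by simp
    have i4: "integrable (config_space N) (\<lambda>q. tprod N F (shift k i (- h) q) * \<psi> q)"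
      using integrable_preserving[OF distr_shift[OF k, of i "- h"] shift_measurable[OF k, of i "- h"] i1] by simp
    have pd: "partial_deriv k i (tprod N (F((k, i) := b))) q = tprod N F q - tprod N F (shift k i (- h) q)" for q
      unfolding partial_deriv_tprod[of k N "F((k, i) := b)", OF k sm]
      by (simp add: b(2) tprod_upd[OF k] tprod_shift[OF k] tprod_split[OF k, of F q i] left_diff_distrib)
    have "(LINT q|config_space N. tprod N F q * line_int k i h G q) =
        (LINT q|config_space N. G q * tprod N (F((k, i) := b)) q)"
      by (subst integral_mult_line_int[OF k h G _ B]) (simp_all add: avg mult.commute)
    also have "\<dots> = - (LINT q|config_space N. \<psi> q * partial_deriv k i (tprod N (F((k, i) := b))) q)"
      using w[OF b(1)] by simp
    also have "\<dots> = - (LINT q|config_space N. tprod N F q * \<psi> q - tprod N F (shift k i (- h) q) * \<psi> q)"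
      by (simp add: pd algebra_simps)
    also have "\<dots> = (LINT q|config_space N. tprod N F (shift k i (- h) q) * \<psi> q) - (LINT q|config_space N. tprod N F q * \<psi> q)"
      using i2 i4 by (simp add: Bochner_Integration.integral_diff)
    finally have "(LINT q|config_space N. tprod N F q * line_int k i h G q) = \<dots>" .
    with tr have "(LINT q|config_space N. tprod N F q * \<psi> (shift k i h q) - tprod N F q * \<psi> q - tprod N F q * line_int k i h G q) = 0"
      using i1 i2 i3 by (simp add: Bochner_Integration.integral_diff)
    then show "(LINT q|config_space N. ?f q * tprod N F q) = 0"
      by (simp add: algebra_simps)
  qed
  then show ?thesis unfolding translates_def by simp
qed

section \<open>From translation identities back to weak derivatives\<close>

lemma test_function_bounds:
  assumes k: "k < N" and \<phi>: "\<phi> \<in> test_functions N"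
  obtains L R where "0 \<le> L"
    and "\<phi> \<in> borel_measurable (config_space N)"
    and "partial_deriv k i \<phi> \<in> borel_measurable (config_space N)"
    and "\<And>q. q \<in> space (config_space N) \<Longrightarrow> \<bar>\<phi> q\<bar> \<le> L * indicator (cube N R) q"
    and "\<And>q. q \<in> space (config_space N) \<Longrightarrow> \<bar>partial_deriv k i \<phi> q\<bar> \<le> L * indicator (cube N R) q"
    and "\<And>q s. q \<in> space (config_space N) \<Longrightarrow>
      ((\<lambda>t. \<phi> (shift k i t q)) has_real_derivative partial_deriv k i \<phi> (shift k i s q)) (at s)"
proof -
  let ?S = "space (config_space N)"
  obtain K where K: "compact K" "K \<subseteq> ?S" "\<And>q. q \<in> ?S - K \<Longrightarrow> \<phi> q = 0"
    using \<phi> by (auto simp: test_functions_def)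
  have "cont_diff N (Suc 0) \<phi>" using \<phi> by (simp add: test_functions_def del: cont_diff.simps)
  with k have c: "continuous_on ?S \<phi>" and c': "continuous_on ?S (partial_deriv k i \<phi>)"
    and d: "\<And>q. q \<in> ?S \<Longrightarrow> (\<lambda>t. \<phi> (q(k := q k + t *\<^sub>R axis i 1))) field_differentiable (at 0)"
    by auto
  have d0: "((\<lambda>t. \<phi> (shift k i t q)) has_real_derivative partial_deriv k i \<phi> q) (at 0)" if "q \<in> ?S" for q
    using d[OF that] unfolding shift_def partial_deriv_def
    by (simp add: field_differentiable_derivI)
  have ds: "((\<lambda>t. \<phi> (shift k i t q)) has_real_derivative partial_deriv k i \<phi> (shift k i s q)) (at s)"
    if "q \<in> ?S" for q s
    using d0[of "shift k i s q"] that k DERIV_shift[of "\<lambda>t. \<phi> (shift k i t q)" _ 0 s]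
    by (simp add: add.commute)
  \<comment> \<open>A continuous function that dominates every coordinate: its bound on
    \<open>K\<close> is the size of a cube containing \<open>K\<close>.\<close>
  define m :: "config \<Rightarrow> real" where "m = (\<lambda>q. \<Sum>p\<in>{..<N} \<times> UNIV. \<bar>q (fst p) $ snd p\<bar>)"
  have "continuous_on K m" unfolding m_def
    by (intro continuous_on_sum continuous_on_rabs continuous_on_coord)
  then have "bounded (m ` K)" by (intro compact_imp_bounded compact_continuous_image K)
  then obtain R where R: "\<And>q. q \<in> K \<Longrightarrow> \<bar>m q\<bar> \<le> R" unfolding bounded_iff by auto
  have Kc: "K \<subseteq> cube N R"
  proof
    fix q assume q: "q \<in> K"
    have "\<bar>q j $ l\<bar> \<le> R" if "j < N" for j l
    proof -
      have "(\<lambda>p. \<bar>q (fst p) $ snd p\<bar>) (j, l) \<le> m q" unfolding m_def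
        by (rule member_le_sum) (use that in auto)
      then show ?thesis using R[OF q] by simp
    qed
    then show "q \<in> cube N R" using q K(2) by (auto simp: cube_def)
  qed
  have cS: "cube N R \<subseteq> ?S" by (auto simp: cube_def)
  have "bounded (\<phi> ` cube N R)" "bounded (partial_deriv k i \<phi> ` cube N R)"
    by (intro compact_imp_bounded compact_continuous_image compact_cube continuous_on_subset[OF _ cS] c c')+
  then obtain L1 L2 where L1: "\<And>q. q \<in> cube N R \<Longrightarrow> \<bar>\<phi> q\<bar> \<le> L1"
    and L2: "\<And>q. q \<in> cube N R \<Longrightarrow> \<bar>partial_deriv k i \<phi> q\<bar> \<le> L2"
    unfolding bounded_iff by auto
  \<comment> \<open>Outside the closed cube some coordinate exceeds \<open>R\<close> strictly. This
    persists for small translations, so \<phi> vanishes near \<open>t = 0\<close> on the line and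
    has derivative 0 there.\<close>
  have out: "partial_deriv k i \<phi> q = 0" if q: "q \<in> ?S" "q \<notin> cube N R" for q
  proof -
    obtain j l where jl: "j < N" "R < \<bar>q j $ l\<bar>" using q by (auto simp: cube_def not_le)
    let ?T = "{t. R < \<bar>shift k i t q j $ l\<bar>}"
    have op: "open ?T"
      by (rule open_Collect_less; cases "(j, l) = (k, i)") (auto intro!: continuous_intros)
    have zero: "\<phi> (shift k i t q) = 0" if "t \<in> ?T" for t
    proof (rule K(3))
      have "shift k i t q \<notin> cube N R" using that jl(1) by (auto simp: cube_def not_le simp del: shift_nth)
      then show "shift k i t q \<in> ?S - K" using Kc q(1) k by auto
    qed
    have "((\<lambda>t. \<phi> (shift k i t q)) has_real_derivative 0) (at 0)"
    proof (rule has_field_derivative_transform_within_open[OF _ op])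
      show "((\<lambda>_. 0 :: real) has_real_derivative 0) (at 0)" by simp
      show "0 \<in> ?T" using jl by auto
      show "0 = \<phi> (shift k i t q)" if "t \<in> ?T" for t using zero[OF that] by simp
    qed
    then show ?thesis using d0[OF q(1)] DERIV_unique by blast
  qed
  show ?thesis
  proof (rule that[where L="max 0 (max L1 L2)" and R=R])
    fix q assume q: "q \<in> ?S"
    show "\<bar>\<phi> q\<bar> \<le> max 0 (max L1 L2) * indicator (cube N R) q"
      using L1[of q] K(3)[of q] q Kc by (cases "q \<in> cube N R") auto
    show "\<bar>partial_deriv k i \<phi> q\<bar> \<le> max 0 (max L1 L2) * indicator (cube N R) q"
      using L2[of q] out[of q] q by (cases "q \<in> cube N R") auto
  next
    show "\<phi> \<in> borel_measurable (config_space N)" "partial_deriv k i \<phi> \<in> borel_measurable (config_space N)"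
      by (intro measurable_continuous_on_config_space c c')+
    show "0 \<le> max 0 (max L1 L2)" by simp
  qed (rule ds)
qed

text \<open>Test the identity against \<phi> and divide by \<open>h\<close>. On one side the
  translation moves to \<phi> and leaves a difference quotient of \<phi> against \<psi>, on the
  other side it leaves an average of \<phi> against \<open>G\<close>; both converge as
  \<open>h\<close> tends to 0.\<close>

lemma translates_imp_weak_deriv:
  assumes k [measurable]: "k < N" and \<psi>: "loc_int N \<psi>" and G: "loc_int N G"
    and tr: "\<And>n. translates N k i \<psi> G (1 / real (Suc n))"
    and \<phi>: "\<phi> \<in> test_functions N"
  shows "(LINT q|config_space N. \<psi> q * partial_deriv k i \<phi> q) = - (LINT q|config_space N. G q * \<phi> q)"
proof -
  let ?S = "space (config_space N)"
  have [measurable]: "\<psi> \<in> borel_measurable (config_space N)" "G \<in> borel_measurable (config_space N)"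
    using \<psi> G by (simp_all add: loc_int_def)
  obtain L R where L: "0 \<le> L"
    and [measurable]: "\<phi> \<in> borel_measurable (config_space N)" "partial_deriv k i \<phi> \<in> borel_measurable (config_space N)"
    and b\<phi>: "\<And>q. q \<in> ?S \<Longrightarrow> \<bar>\<phi> q\<bar> \<le> L * indicator (cube N R) q"
    and bd: "\<And>q. q \<in> ?S \<Longrightarrow> \<bar>partial_deriv k i \<phi> q\<bar> \<le> L * indicator (cube N R) q"
    and D: "\<And>q s. q \<in> ?S \<Longrightarrow>
      ((\<lambda>t. \<phi> (shift k i t q)) has_real_derivative partial_deriv k i \<phi> (shift k i s q)) (at s)"
    by (rule test_function_bounds[OF k \<phi>, where i=i]) (rule that; assumption)
  define h where "h n = 1 / real (Suc n)" for n
  have h: "0 < h n" "h n \<le> 1" for n by (auto simp: h_def)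
  have hn: "h n \<noteq> 0" for n by (simp add: h_def)
  have hl: "h \<longlonglongrightarrow> 0" using LIMSEQ_inverse_real_of_nat by (simp add: h_def[abs_def] inverse_eq_divide)
  \<comment> \<open>As \<open>h n \<le> 1\<close>, all translated supports lie in the cube of size
    \<open>R + 1\<close>, which gives a dominating function independent of \<open>n\<close>.\<close>
  have near: "indicator (cube N R) (shift k i t q) \<le> (indicator (cube N (R + 1)) q :: real)"
    if "q \<in> ?S" "\<bar>t\<bar> \<le> 1" for q t
    using k that by (rule indicator_cube_shift)
  have dom: "integrable (config_space N) (\<lambda>q. L * indicator (cube N (R + 1)) q * \<bar>f q\<bar>)" if "loc_int N f" for f
  proof -
    have "integrable (config_space N) (\<lambda>q. L * \<bar>indicator (cube N (R + 1)) q * f q\<bar>)"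
      using that by (auto simp: loc_int_def)
    then show ?thesis by (simp add: abs_mult mult.assoc)
  qed
  \<comment> \<open>The translation acts on \<phi> with reversed sign, so \<open>Q n\<close> tends
    to minus the partial derivative: this is the sign in the integration by parts. The averages
    \<open>A n\<close> tend to \<phi>.\<close>
  define Q where "Q n q = (\<phi> (shift k i (- h n) q) - \<phi> q) / h n" for n q
  define A where "A n q = (LINT t|lborel. indicator {0..h n} t * \<phi> (shift k i (- t) q)) / h n" for n q
  have [measurable]: "Q n \<in> borel_measurable (config_space N)" "A n \<in> borel_measurable (config_space N)" for n
    unfolding Q_def[abs_def] A_def[abs_def] by measurable
  have eq: "(LINT q|config_space N. Q n q * \<psi> q) = (LINT q|config_space N. A n q * G q)" for n
  proof -
    have i1: "integrable (config_space N) (\<lambda>q. \<phi> q * \<psi> (shift k i (h n) q))"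
      by (rule loc_int_integrable[OF loc_int_shift[OF k \<psi>] _ b\<phi>]) measurable
    have i2: "integrable (config_space N) (\<lambda>q. \<phi> q * \<psi> q)"
      by (rule loc_int_integrable[OF \<psi> _ b\<phi>]) measurable
    have i3: "integrable (config_space N) (\<lambda>q. \<phi> (shift k i (- h n) q) * \<psi> q)"
      using integrable_preserving[OF distr_shift[OF k, of i "- h n"] shift_measurable[OF k, of i "- h n"] i1] by simp
    have "Q n q * \<psi> q * h n = \<phi> (shift k i (- h n) q) * \<psi> q - \<phi> q * \<psi> q" for q
      using h(1)[of n] by (simp add: Q_def field_simps)
    then have "(LINT q|config_space N. Q n q * \<psi> q) * h n =
        (LINT q|config_space N. \<phi> (shift k i (- h n) q) * \<psi> q - \<phi> q * \<psi> q)"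
      by (subst integral_mult_left_zero[symmetric]) simp
    also have "\<dots> = (LINT q|config_space N. \<phi> (shift k i (- h n) q) * \<psi> q) - (LINT q|config_space N. \<phi> q * \<psi> q)"
      by (rule Bochner_Integration.integral_diff[OF i3 i2])
    also have "(LINT q|config_space N. \<phi> (shift k i (- h n) q) * \<psi> q) = (LINT q|config_space N. \<phi> q * \<psi> (shift k i (h n) q))"
      using integral_preserving[OF distr_shift[OF k, of i "- h n"] shift_measurable[OF k, of i "- h n"],
          of "\<lambda>q. \<phi> q * \<psi> (shift k i (h n) q)"] by simp
    also have "\<dots> - (LINT q|config_space N. \<phi> q * \<psi> q) =
        (LINT q|config_space N. \<phi> q * \<psi> (shift k i (h n) q) - \<phi> q * \<psi> q)"
      by (rule Bochner_Integration.integral_diff[OF i1 i2, symmetric])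
    also have "\<dots> = (LINT q|config_space N. \<phi> q * line_int k i (h n) G q)"
    proof (rule integral_cong_AE)
      show "AE q in config_space N. \<phi> q * \<psi> (shift k i (h n) q) - \<phi> q * \<psi> q = \<phi> q * line_int k i (h n) G q"
        using tr[of n] unfolding translates_def h_def by eventually_elim (simp add: right_diff_distrib[symmetric])
    qed measurable
    also have "\<dots> = (LINT q|config_space N. (LINT t|lborel. indicator {0..h n} t * \<phi> (shift k i (- t) q)) * G q)"
      by (rule integral_mult_line_int[OF k less_imp_le[OF h(1)] G _ L b\<phi>]) measurable
    also have "\<dots> = (LINT q|config_space N. A n q * G q) * h n"
      using h(1)[of n] by (subst integral_mult_left_zero[symmetric]) (simp add: A_def)
    finally show ?thesis using h(1)[of n] by simp
  qed
  have "(\<lambda>n. LINT q|config_space N. Q n q * \<psi> q) \<longlonglongrightarrow> (LINT q|config_space N. - partial_deriv k i \<phi> q * \<psi> q)"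
  proof (rule integral_dominated_convergence[OF _ _ dom[OF \<psi>]])
    show "AE q in config_space N. (\<lambda>n. Q n q * \<psi> q) \<longlonglongrightarrow> - partial_deriv k i \<phi> q * \<psi> q"
    proof (rule AE_I2)
      fix q assume q: "q \<in> ?S"
      have "((\<lambda>t. (\<phi> (shift k i t q) - \<phi> q) / t) \<longlongrightarrow> partial_deriv k i \<phi> q) (at 0)"
        using D[OF q, of 0] by (simp add: DERIV_def)
      moreover have "filterlim (\<lambda>n. - h n) (at 0) sequentially"
        using tendsto_minus[OF hl] by (simp add: filterlim_at hn)
      ultimately have "(\<lambda>n. (\<phi> (shift k i (- h n) q) - \<phi> q) / (- h n)) \<longlonglongrightarrow> partial_deriv k i \<phi> q"
        by (rule filterlim_compose)
      from tendsto_minus[OF this] have "(\<lambda>n. Q n q) \<longlonglongrightarrow> - partial_deriv k i \<phi> q"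
        by (simp add: Q_def)
      then show "(\<lambda>n. Q n q * \<psi> q) \<longlonglongrightarrow> - partial_deriv k i \<phi> q * \<psi> q" by (intro tendsto_intros)
    qed
    fix n
    show "AE q in config_space N. norm (Q n q * \<psi> q) \<le> L * indicator (cube N (R + 1)) q * \<bar>\<psi> q\<bar>"
    proof (rule AE_I2)
      fix q assume q: "q \<in> ?S"
      obtain z where z: "- h n < z" "z < 0"
        "\<phi> (shift k i 0 q) - \<phi> (shift k i (- h n) q) = (0 - (- h n)) * partial_deriv k i \<phi> (shift k i z q)"
        using MVT2[of "- h n" 0 "\<lambda>t. \<phi> (shift k i t q)" "\<lambda>z. partial_deriv k i \<phi> (shift k i z q)"] h(1)[of n] D[OF q]
        by auto
      have "\<bar>Q n q\<bar> = \<bar>partial_deriv k i \<phi> (shift k i z q)\<bar>"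
        using z(3) h(1)[of n] by (simp add: Q_def abs_minus_commute abs_mult)
      also have "\<dots> \<le> L * indicator (cube N R) (shift k i z q)" using q k by (intro bd) simp
      also have "\<dots> \<le> L * indicator (cube N (R + 1)) q"
        using z h(2)[of n] q L by (intro mult_left_mono near) auto
      finally show "norm (Q n q * \<psi> q) \<le> L * indicator (cube N (R + 1)) q * \<bar>\<psi> q\<bar>"
        by (simp add: abs_mult mult_right_mono)
    qed
  qed measurable
  moreover have "(\<lambda>n. LINT q|config_space N. A n q * G q) \<longlonglongrightarrow> (LINT q|config_space N. \<phi> q * G q)"
  proof (rule integral_dominated_convergence[OF _ _ dom[OF G]])
    \<comment> \<open>The average is itself a difference quotient, that of an antiderivative along
      the reversed line, so its limit and its bound are obtained as for \<open>Q\<close>.\<close>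
    have *: "\<exists>S. (\<forall>x. (S has_real_derivative \<phi> (shift k i (- x) q)) (at x)) \<and> (\<forall>n. A n q = (S (h n) - S 0) / h n)"
      if q: "q \<in> ?S" for q
    proof -
      have "isCont (\<lambda>t. \<phi> (shift k i (- t) q)) t" for t
        using DERIV_isCont[OF D[OF q, of "- t"]]
        by (rule isCont_o2[rotated]) (intro continuous_intros)
      then have "continuous_on UNIV (\<lambda>t. \<phi> (shift k i (- t) q))"
        by (intro continuous_at_imp_continuous_on) auto
      then obtain S where S: "\<And>x. (S has_real_derivative \<phi> (shift k i (- x) q)) (at x)"
        and I: "\<And>a b. a \<le> b \<Longrightarrow> (LINT t|lborel. indicator {a..b} t * \<phi> (shift k i (- t) q)) = S b - S a"
        by (rule ex_antiderivative) (rule that; assumption)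
      show ?thesis
        by (intro exI[of _ S] conjI allI S) (simp add: A_def I less_imp_le[OF h(1)])
    qed
    show "AE q in config_space N. (\<lambda>n. A n q * G q) \<longlonglongrightarrow> \<phi> q * G q"
    proof (rule AE_I2)
      fix q assume q: "q \<in> ?S"
      obtain S where S: "\<And>x. (S has_real_derivative \<phi> (shift k i (- x) q)) (at x)"
        and A: "\<And>n. A n q = (S (h n) - S 0) / h n" using *[OF q] by blast
      have "((\<lambda>t. (S t - S 0) / t) \<longlongrightarrow> \<phi> q) (at 0)"
        using S[of 0] by (simp add: DERIV_def)
      moreover have "filterlim h (at 0) sequentially"
        using hl by (simp add: filterlim_at hn)
      ultimately have "(\<lambda>n. A n q) \<longlonglongrightarrow> \<phi> q"
        unfolding A by (rule filterlim_compose)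
      then show "(\<lambda>n. A n q * G q) \<longlonglongrightarrow> \<phi> q * G q" by (intro tendsto_intros)
    qed
    fix n
    show "AE q in config_space N. norm (A n q * G q) \<le> L * indicator (cube N (R + 1)) q * \<bar>G q\<bar>"
    proof (rule AE_I2)
      fix q assume q: "q \<in> ?S"
      obtain S where S: "\<And>x. (S has_real_derivative \<phi> (shift k i (- x) q)) (at x)"
        and A: "\<And>n. A n q = (S (h n) - S 0) / h n" using *[OF q] by blast
      obtain z where z: "0 < z" "z < h n" "S (h n) - S 0 = (h n - 0) * \<phi> (shift k i (- z) q)"
        using MVT2[of 0 "h n" S "\<lambda>x. \<phi> (shift k i (- x) q)"] h(1)[of n] S by auto
      have "\<bar>A n q\<bar> = \<bar>\<phi> (shift k i (- z) q)\<bar>" using z(3) h(1)[of n] by (simp add: A)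
      also have "\<dots> \<le> L * indicator (cube N R) (shift k i (- z) q)" using q k by (intro b\<phi>) simp
      also have "\<dots> \<le> L * indicator (cube N (R + 1)) q"
        using z h(2)[of n] q L by (intro mult_left_mono near) auto
      finally show "norm (A n q * G q) \<le> L * indicator (cube N (R + 1)) q * \<bar>G q\<bar>"
        by (simp add: abs_mult mult_right_mono)
    qed
  qed measurable
  ultimately have "(LINT q|config_space N. - partial_deriv k i \<phi> q * \<psi> q) = (LINT q|config_space N. \<phi> q * G q)"
    unfolding eq by (rule LIMSEQ_unique)
  then show ?thesis by (simp add: mult.commute)
qed

section \<open>Uniqueness of weak gradients and a Hardy inequality\<close>

lemma square_integrable_nth:
  fixes g :: "config \<Rightarrow> real^3"
  assumes "square_integrable (config_space N) g"
  shows "(\<lambda>q. g q $ i) \<in> borel_measurable (config_space N)"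
    and "integrable (config_space N) (\<lambda>q. (g q $ i)\<^sup>2)"
    and "loc_int N (\<lambda>q. g q $ i)"
proof -
  have [measurable]: "g \<in> borel_measurable (config_space N)"
    and i: "integrable (config_space N) (\<lambda>q. (norm (g q))\<^sup>2)"
    using assms by (auto simp: square_integrable_def)
  show m: "(\<lambda>q. g q $ i) \<in> borel_measurable (config_space N)" by measurable
  show sq: "integrable (config_space N) (\<lambda>q. (g q $ i)\<^sup>2)"
  proof (rule Bochner_Integration.integrable_bound[OF i])
    have "(g q $ i)\<^sup>2 \<le> (norm (g q))\<^sup>2" for q
      using power_mono[OF component_le_norm_cart[of "g q" i], of 2] by simp
    then show "AE q in config_space N. norm ((g q $ i)\<^sup>2) \<le> norm ((norm (g q))\<^sup>2)" by simp
  qed measurable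
  show "loc_int N (\<lambda>q. g q $ i)" by (rule loc_int_L2[OF m sq])
qed

lemma square_integrable_loc_int: "square_integrable (config_space N) \<psi> \<Longrightarrow> loc_int N \<psi>"
  for \<psi> :: "config \<Rightarrow> real"
  by (rule loc_int_L2) (simp_all add: square_integrable_def)

lemma has_weak_gradient_translates:
  assumes "loc_int N \<psi>" "has_weak_gradient N \<psi> g" "k < N" "0 \<le> h"
  shows "translates N k i \<psi> (\<lambda>q. g k q $ i) h"
proof (rule weak_deriv_imp_translates[OF assms(3,1) _ assms(4)])
  show "loc_int N (\<lambda>q. g k q $ i)"
    using assms by (intro square_integrable_nth) (simp add: has_weak_gradient_def)
  show "(LINT q|config_space N. \<psi> q * partial_deriv k i (tprod N F) q) = - (LINT q|config_space N. g k q $ i * tprod N F q)"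
    if "testfam F" for F
    using assms(2,3) tprod_test_functions[OF that, of N] unfolding has_weak_gradient_def by blast
qed

text \<open>This form asks for countably many almost-everywhere statements, since particles and axes
  are finite in number; it can therefore be verified on almost every slice simultaneously.\<close>

lemma has_weak_gradientI:
  assumes "loc_int N \<psi>" "\<And>k. k < N \<Longrightarrow> square_integrable (config_space N) (g k)"
    and "\<And>k i n. k < N \<Longrightarrow> translates N k i \<psi> (\<lambda>q. g k q $ i) (1 / real (Suc n))"
  shows "has_weak_gradient N \<psi> g"
  unfolding has_weak_gradient_def
proof (intro allI impI conjI ballI assms(2))
  fix k i \<phi> assume "k < N" "\<phi> \<in> test_functions N"
  then show "(LINT q|config_space N. \<psi> q * partial_deriv k i \<phi> q) = - (LINT q|config_space N. g k q $ i * \<phi> q)"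
    by (intro translates_imp_weak_deriv assms square_integrable_nth)
qed

text \<open>Both gradients have equal integrals against all test functions, so the fundamental lemma
  applies to the difference of each component. An explicitly known gradient may thus replace the one
  chosen by \<open>SOME\<close> in the energy.\<close>

lemma weak_gradient_unique:
  assumes \<psi>: "loc_int N \<psi>" "loc_int N \<psi>'" and eq: "AE q in config_space N. \<psi> q = \<psi>' q"
    and g: "has_weak_gradient N \<psi> g" "has_weak_gradient N \<psi>' g'" and k: "k < N"
  shows "AE q in config_space N. g k q = g' k q"
proof -
  have sq: "square_integrable (config_space N) (g k)" "square_integrable (config_space N) (g' k)"
    using g k by (auto simp: has_weak_gradient_def)
  have "AE q in config_space N. g k q $ i - g' k q $ i = 0" for i
  proof (rule fundamental_lemma)
    show "loc_int N (\<lambda>q. g k q $ i - g' k q $ i)"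
      by (intro loc_int_diff square_integrable_nth sq)
    fix F assume F: "testfam F"
    have tf: "tprod N F \<in> test_functions N" by (rule tprod_test_functions[OF F])
    have m [measurable]: "tprod N F \<in> borel_measurable (config_space N)" by (rule testfam_tprod_measurable[OF F])
    obtain B R where B: "0 \<le> B" "\<And>q. q \<in> space (config_space N) \<Longrightarrow> \<bar>tprod N F q\<bar> \<le> B * indicator (cube N R) q"
      using tprod_bound[OF F, of N] by blast
    have [measurable]: "partial_deriv k i (tprod N F) \<in> borel_measurable (config_space N)"
      using test_function_bounds[OF k tf, of i] by blast
    have [measurable]: "\<psi> \<in> borel_measurable (config_space N)" "\<psi>' \<in> borel_measurable (config_space N)"
      using \<psi> by (simp_all add: loc_int_def)
    have "(LINT q|config_space N. g k q $ i * tprod N F q) = - (LINT q|config_space N. \<psi> q * partial_deriv k i (tprod N F) q)"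
      using g(1) k tf unfolding has_weak_gradient_def by fastforce
    also have "(LINT q|config_space N. \<psi> q * partial_deriv k i (tprod N F) q) = (LINT q|config_space N. \<psi>' q * partial_deriv k i (tprod N F) q)"
      by (rule integral_cong_AE) (use eq in auto)
    also have "- \<dots> = (LINT q|config_space N. g' k q $ i * tprod N F q)"
      using g(2) k tf unfolding has_weak_gradient_def by fastforce
    finally have e: "(LINT q|config_space N. g k q $ i * tprod N F q) = (LINT q|config_space N. g' k q $ i * tprod N F q)" .
    have "integrable (config_space N) (\<lambda>q. tprod N F q * g k q $ i)"
      by (rule loc_int_integrable[OF square_integrable_nth(3)[OF sq(1)] m B(2)])
    moreover have "integrable (config_space N) (\<lambda>q. tprod N F q * g' k q $ i)"
      by (rule loc_int_integrable[OF square_integrable_nth(3)[OF sq(2)] m B(2)])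
    ultimately show "(LINT q|config_space N. (g k q $ i - g' k q $ i) * tprod N F q) = 0"
      using e by (simp add: right_diff_distrib Bochner_Integration.integral_diff mult.commute[of _ "tprod N F _"])
  qed
  then have "AE q in config_space N. \<forall>i\<in>UNIV. g k q $ i - g' k q $ i = 0"
    by (intro AE_finite_allI) auto
  then show ?thesis by eventually_elim (simp add: vec_eq_iff)
qed

section \<open>Weighted bounds from integration over segments\<close>

lemma line_Cauchy_Schwarz:
  fixes f :: "real \<Rightarrow> real"
  assumes [measurable]: "f \<in> borel_measurable borel" and t: "0 \<le> t" "t \<le> 1"
  shows "ennreal ((LINT s|lborel. indicator {0..t} s * f s)\<^sup>2) \<le> (\<integral>\<^sup>+s. indicator {0..1} s * ennreal ((f s)\<^sup>2) \<partial>lborel)"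
proof (cases "integrable lborel (\<lambda>s. indicator {0..1} s * (f s)\<^sup>2)")
  case False
  \<comment> \<open>Here the upper bound is infinite, whatever default value the integral on the
    left takes.\<close>
  then have "(\<integral>\<^sup>+s. ennreal (norm (indicator {0..1} s * (f s)\<^sup>2)) \<partial>lborel) = \<infinity>"
    by (simp add: integrable_iff_bounded not_less top_unique)
  moreover have "ennreal (norm (indicator {0..1} s * (f s)\<^sup>2)) = indicator {0..1} s * ennreal ((f s)\<^sup>2)" for s
    by (auto simp: indicator_def)
  ultimately show ?thesis by simp
next
  case True
  have abs_le: "\<bar>x\<bar> \<le> 1 + x\<^sup>2" for x :: real
    using sum_squares_bound[of "\<bar>x\<bar>" 1] by (simp add: power2_eq_square)
  have sq: "integrable lborel (\<lambda>s. indicator {0..t} s * (f s)\<^sup>2)"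
    by (rule Bochner_Integration.integrable_bound[OF True]) (use t in \<open>auto simp: indicator_def\<close>)
  have lin: "integrable lborel (\<lambda>s. indicator {0..t} s * f s)"
  proof (rule Bochner_Integration.integrable_bound)
    show "integrable lborel (\<lambda>s. indicator {0..t} s + indicator {0..t} s * (f s)\<^sup>2)"
      by (intro Bochner_Integration.integrable_add sq) (simp add: integrable_indicator_iff t)
    show "AE s in lborel. norm (indicator {0..t} s * f s) \<le> norm (indicator {0..t} s + indicator {0..t} s * (f s)\<^sup>2)"
      by (auto simp: indicator_def abs_le)
  qed measurable
  define X where "X = (LINT s|lborel. indicator {0..t} s * f s)"
  \<comment> \<open>Expanding the square gives \<open>0 \<le> I - 2 X^2 + t X^2\<close>, where
    \<open>I\<close> is the integral of \<open>f^2\<close> over \<open>{0..t}\<close>; with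
    \<open>t \<le> 1\<close> this is \<open>X^2 \<le> I\<close>. Enlarging the interval to
    \<open>{0..1}\<close> makes the bound independent of \<open>t\<close>.\<close>
  have "0 \<le> (LINT s|lborel. indicator {0..t} s * (f s - X)\<^sup>2)"
    by (rule Bochner_Integration.integral_nonneg) auto
  also have "(LINT s|lborel. indicator {0..t} s * (f s - X)\<^sup>2) =
      (LINT s|lborel. indicator {0..t} s * (f s)\<^sup>2 - 2 * X * (indicator {0..t} s * f s) + X\<^sup>2 * indicator {0..t} s)"
    by (rule Bochner_Integration.integral_cong) (auto simp: power2_eq_square algebra_simps)
  also have "\<dots> = (LINT s|lborel. indicator {0..t} s * (f s)\<^sup>2) - 2 * X * X + X\<^sup>2 * t"
    using sq lin t by (simp add: X_def Bochner_Integration.integral_diff Bochner_Integration.integral_add)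
  also have "\<dots> \<le> (LINT s|lborel. indicator {0..1} s * (f s)\<^sup>2) - 2 * X * X + X\<^sup>2"
    using t by (intro add_mono diff_mono order_refl integral_mono sq True mult_left_le) (auto simp: indicator_def)
  finally have "X\<^sup>2 \<le> (LINT s|lborel. indicator {0..1} s * (f s)\<^sup>2)"
    by (simp add: power2_eq_square)
  then have "ennreal (X\<^sup>2) \<le> ennreal (LINT s|lborel. indicator {0..1} s * (f s)\<^sup>2)"
    by (rule ennreal_leI)
  also have "\<dots> = (\<integral>\<^sup>+s. ennreal (indicator {0..1} s * (f s)\<^sup>2) \<partial>lborel)"
    using True by (subst nn_integral_eq_integral) auto
  also have "\<dots> = (\<integral>\<^sup>+s. indicator {0..1} s * ennreal ((f s)\<^sup>2) \<partial>lborel)"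
    by (rule nn_integral_cong) (auto simp: indicator_def)
  finally show ?thesis by (simp add: X_def)
qed

text \<open>Both left sides are the same double integral in a different order. Translating
  \<open>q\<close> moves the shift from \<open>f\<close> to \<open>w\<close>, of which only the
  integral over a reversed segment remains.\<close>

lemma nn_integral_weighted_line:
  fixes w f :: "config \<Rightarrow> ennreal"
  assumes k [measurable]: "k < N"
    and [measurable]: "w \<in> borel_measurable (config_space N)" "f \<in> borel_measurable (config_space N)"
    and C: "\<And>q. q \<in> space (config_space N) \<Longrightarrow> (\<integral>\<^sup>+s. indicator {0..1} s * w (shift k i (- s) q) \<partial>lborel) \<le> C"
  shows "(\<integral>\<^sup>+q. w q * (\<integral>\<^sup>+s. indicator {0..1} s * f (shift k i s q) \<partial>lborel) \<partial>config_space N)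
    \<le> C * (\<integral>\<^sup>+q. f q \<partial>config_space N)"
    and "(\<integral>\<^sup>+s. indicator {0..1} s * (\<integral>\<^sup>+q. w q * f (shift k i s q) \<partial>config_space N) \<partial>lborel)
    \<le> C * (\<integral>\<^sup>+q. f q \<partial>config_space N)"
proof -
  have "(\<integral>\<^sup>+q. w q * (\<integral>\<^sup>+s. indicator {0..1} s * f (shift k i s q) \<partial>lborel) \<partial>config_space N) =
      (\<integral>\<^sup>+q. \<integral>\<^sup>+s. indicator {0..1} s * (w q * f (shift k i s q)) \<partial>lborel \<partial>config_space N)"
  proof (rule nn_integral_cong)
    fix q assume [measurable]: "q \<in> space (config_space N)"
    show "w q * (\<integral>\<^sup>+s. indicator {0..1} s * f (shift k i s q) \<partial>lborel) =
        (\<integral>\<^sup>+s. indicator {0..1} s * (w q * f (shift k i s q)) \<partial>lborel)"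
      by (subst nn_integral_cmult[symmetric]) (auto simp: mult.left_commute)
  qed
  also have "\<dots> = (\<integral>\<^sup>+s. \<integral>\<^sup>+q. indicator {0..1} s * (w q * f (shift k i s q)) \<partial>config_space N \<partial>lborel)"
    by (rule csl.Fubini'[symmetric]) measurable
  also have 1: "\<dots> = (\<integral>\<^sup>+s. indicator {0..1} s * (\<integral>\<^sup>+q. w q * f (shift k i s q) \<partial>config_space N) \<partial>lborel)"
    by (intro nn_integral_cong nn_integral_cmult) measurable
  finally have e: "(\<integral>\<^sup>+q. w q * (\<integral>\<^sup>+s. indicator {0..1} s * f (shift k i s q) \<partial>lborel) \<partial>config_space N) = \<dots>" .
  have "(\<integral>\<^sup>+s. \<integral>\<^sup>+q. indicator {0..1} s * (w q * f (shift k i s q)) \<partial>config_space N \<partial>lborel) =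
      (\<integral>\<^sup>+s. \<integral>\<^sup>+q. indicator {0..1} s * (w (shift k i (- s) q) * f q) \<partial>config_space N \<partial>lborel)"
  proof (rule nn_integral_cong)
    fix s :: real
    show "(\<integral>\<^sup>+q. indicator {0..1} s * (w q * f (shift k i s q)) \<partial>config_space N) =
        (\<integral>\<^sup>+q. indicator {0..1} s * (w (shift k i (- s) q) * f q) \<partial>config_space N)"
      using nn_integral_preserving[OF distr_shift[OF k, of i "- s"] shift_measurable[OF k, of i "- s"],
          of "\<lambda>q. indicator {0..1} s * (w q * f (shift k i s q))"] by simp
  qed
  also have "\<dots> = (\<integral>\<^sup>+q. \<integral>\<^sup>+s. indicator {0..1} s * (w (shift k i (- s) q) * f q) \<partial>lborel \<partial>config_space N)"
    by (rule csl.Fubini') measurable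
  also have "\<dots> = (\<integral>\<^sup>+q. (\<integral>\<^sup>+s. indicator {0..1} s * w (shift k i (- s) q) \<partial>lborel) * f q \<partial>config_space N)"
  proof (rule nn_integral_cong)
    fix q assume [measurable]: "q \<in> space (config_space N)"
    show "(\<integral>\<^sup>+s. indicator {0..1} s * (w (shift k i (- s) q) * f q) \<partial>lborel) =
        (\<integral>\<^sup>+s. indicator {0..1} s * w (shift k i (- s) q) \<partial>lborel) * f q"
      by (subst nn_integral_multc[symmetric]) (auto simp: mult.assoc)
  qed
  also have "\<dots> \<le> (\<integral>\<^sup>+q. C * f q \<partial>config_space N)"
    by (intro nn_integral_mono mult_right_mono C) auto
  also have "\<dots> = C * (\<integral>\<^sup>+q. f q \<partial>config_space N)"
    by (rule nn_integral_cmult) measurable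
  finally have "(\<integral>\<^sup>+s. indicator {0..1} s * (\<integral>\<^sup>+q. w q * f (shift k i s q) \<partial>config_space N) \<partial>lborel)
    \<le> C * (\<integral>\<^sup>+q. f q \<partial>config_space N)" unfolding 1 .
  then show "(\<integral>\<^sup>+s. indicator {0..1} s * (\<integral>\<^sup>+q. w q * f (shift k i s q) \<partial>config_space N) \<partial>lborel)
    \<le> C * (\<integral>\<^sup>+q. f q \<partial>config_space N)"
    and "(\<integral>\<^sup>+q. w q * (\<integral>\<^sup>+s. indicator {0..1} s * f (shift k i s q) \<partial>lborel) \<partial>config_space N)
    \<le> C * (\<integral>\<^sup>+q. f q \<partial>config_space N)" unfolding e by simp_all
qed

text \<open>Averaging \<open>\<psi> (q)\<^sup>2 \<le> 2 \<psi> (q + t u)\<^sup>2 + 2 (\<integral>\<^sub>0\<^sup>t G (q + s u) ds)\<^sup>2\<close> over \<open>t \<in> [0, 1]\<close> shows that a weight need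
  only be bounded after integration over segments of direction \<open>u\<close>.\<close>

lemma weighted_L2_bound:
  assumes k [measurable]: "k < N"
    and [measurable]: "w \<in> borel_measurable (config_space N)" "\<psi> \<in> borel_measurable (config_space N)" "G \<in> borel_measurable (config_space N)"
    and C: "\<And>q. q \<in> space (config_space N) \<Longrightarrow> (\<integral>\<^sup>+s. indicator {0..1} s * w (shift k i (- s) q) \<partial>lborel) \<le> C"
    and tr: "\<And>h. 0 \<le> h \<Longrightarrow> translates N k i \<psi> G h"
  shows "(\<integral>\<^sup>+q. w q * ennreal ((\<psi> q)\<^sup>2) \<partial>config_space N)
    \<le> 2 * (C * (\<integral>\<^sup>+q. ennreal ((\<psi> q)\<^sup>2) \<partial>config_space N)) + 2 * (C * (\<integral>\<^sup>+q. ennreal ((G q)\<^sup>2) \<partial>config_space N))"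
proof -
  let ?I = "\<integral>\<^sup>+q. w q * ennreal ((\<psi> q)\<^sup>2) \<partial>config_space N"
  let ?J = "\<lambda>q. \<integral>\<^sup>+s. indicator {0..1} s * ennreal ((G (shift k i s q))\<^sup>2) \<partial>lborel"
  let ?E = "\<lambda>t. \<integral>\<^sup>+q. w q * ennreal ((\<psi> (shift k i t q))\<^sup>2) \<partial>config_space N"
  have step: "?I \<le> 2 * ?E t + 2 * (\<integral>\<^sup>+q. w q * ?J q \<partial>config_space N)" if t: "0 \<le> t" "t \<le> 1" for t
  proof -
    have "AE q in config_space N. ennreal ((\<psi> q)\<^sup>2) \<le> 2 * ennreal ((\<psi> (shift k i t q))\<^sup>2) + 2 * ?J q"
      using tr[OF t(1)] AE_space unfolding translates_def
    proof eventually_elim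
      case (elim q)
      note [measurable] = elim(2)
      have "\<psi> q = \<psi> (shift k i t q) - line_int k i t G q" using elim(1) by linarith
      then have "(\<psi> q)\<^sup>2 = (\<psi> (shift k i t q) - line_int k i t G q)\<^sup>2" by (rule arg_cong)
      also have "\<dots> \<le> 2 * (\<psi> (shift k i t q))\<^sup>2 + 2 * (line_int k i t G q)\<^sup>2"
        using zero_le_power2[of "\<psi> (shift k i t q) + line_int k i t G q"]
        by (simp add: power2_eq_square algebra_simps)
      finally have "ennreal ((\<psi> q)\<^sup>2) \<le> ennreal (2 * (\<psi> (shift k i t q))\<^sup>2 + 2 * (line_int k i t G q)\<^sup>2)"
        by (rule ennreal_leI)
      also have "\<dots> = 2 * ennreal ((\<psi> (shift k i t q))\<^sup>2) + 2 * ennreal ((line_int k i t G q)\<^sup>2)"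
        by (simp add: ennreal_mult)
      also have "\<dots> \<le> 2 * ennreal ((\<psi> (shift k i t q))\<^sup>2) + 2 * ?J q"
        unfolding line_int_def by (intro add_mono mult_left_mono line_Cauchy_Schwarz order_refl t) auto
      finally show ?case .
    qed
    then have "?I \<le> (\<integral>\<^sup>+q. w q * (2 * ennreal ((\<psi> (shift k i t q))\<^sup>2) + 2 * ?J q) \<partial>config_space N)"
      by (intro nn_integral_mono_AE) (auto elim!: eventually_mono intro: mult_left_mono)
    also have "\<dots> = (\<integral>\<^sup>+q. 2 * (w q * ennreal ((\<psi> (shift k i t q))\<^sup>2)) + 2 * (w q * ?J q) \<partial>config_space N)"
      by (intro nn_integral_cong) (simp add: distrib_left mult.left_commute)
    also have "\<dots> = 2 * ?E t + 2 * (\<integral>\<^sup>+q. w q * ?J q \<partial>config_space N)"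
      by (subst nn_integral_add) (auto simp: nn_integral_cmult)
    finally show ?thesis .
  qed
  \<comment> \<open>\<open>?I\<close> is its own average over the unit interval. After inserting
    \<open>step\<close>, the first term on the right is averaged in \<open>t\<close> as well, which
    is what makes it finite for a singular weight.\<close>
  have "?I = (\<integral>\<^sup>+t. indicator {0..1} t * ?I \<partial>(lborel :: real measure))"
    by (subst nn_integral_multc) auto
  also have "\<dots> \<le> (\<integral>\<^sup>+t. 2 * (indicator {0..1} t * ?E t) + indicator {0..1} t * (2 * (\<integral>\<^sup>+q. w q * ?J q \<partial>config_space N)) \<partial>lborel)"
    by (intro nn_integral_mono) (use step in \<open>auto simp: indicator_def\<close>)
  also have "\<dots> = 2 * (\<integral>\<^sup>+t. indicator {0..1} t * ?E t \<partial>lborel) + 2 * (\<integral>\<^sup>+q. w q * ?J q \<partial>config_space N)"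
    by (subst nn_integral_add) (auto simp: nn_integral_cmult nn_integral_multc)
  also have "\<dots> \<le> 2 * (C * (\<integral>\<^sup>+q. ennreal ((\<psi> q)\<^sup>2) \<partial>config_space N)) + 2 * (C * (\<integral>\<^sup>+q. ennreal ((G q)\<^sup>2) \<partial>config_space N))"
    by (intro add_mono mult_left_mono nn_integral_weighted_line[OF k _ _ C]) auto
  finally show ?thesis .
qed

text \<open>\<open>1 / |v|\<close> is not uniformly integrable along lines of a fixed direction \<open>i\<close>, but it becomes so when
  restricted to \<open>|v\<^sub>i| \<le> |v\<^sub>j|\<close>; two such cones cover the space.\<close>

definition cone_weight :: "3 \<Rightarrow> 3 \<Rightarrow> real^3 \<Rightarrow> real" where
  "cone_weight i j v = (if \<bar>v $ i\<bar> \<le> \<bar>v $ j\<bar> then 1 / norm v else 0)"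

text \<open>Along the line \<open>v $ j\<close> is constant and bounds the norm from below, so the
  weight is at most \<open>1 / \<bar>v $ j\<bar>\<close>; the part of the line inside the cone has
  length \<open>2 * \<bar>v $ j\<bar>\<close>. The product is 2 for every line. If
  \<open>v $ j = 0\<close>, the line meets the cone in a single point.\<close>

lemma cone_weight_line:
  assumes "i \<noteq> j"
  shows "(\<integral>\<^sup>+s. indicator {0..1} s * ennreal (cone_weight i j (v - s *\<^sub>R axis i 1)) \<partial>lborel) \<le> 2"
proof -
  let ?a = "\<bar>v $ j\<bar>"
  have nth: "(v - s *\<^sub>R axis i 1) $ i = v $ i - s" "(v - s *\<^sub>R axis i 1) $ j = v $ j" for s
    using assms by (auto simp: axis_def)
  have le: "cone_weight i j (v - s *\<^sub>R axis i 1) \<le> 1 / ?a * indicator {v $ i - ?a .. v $ i + ?a} s" if "?a \<noteq> 0" for s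
  proof (cases "\<bar>v $ i - s\<bar> \<le> ?a")
    case True
    have "?a \<le> norm (v - s *\<^sub>R axis i 1)"
      using component_le_norm_cart[of "v - s *\<^sub>R axis i 1" j] by (simp only: nth)
    then have "1 / norm (v - s *\<^sub>R axis i 1) \<le> 1 / ?a" using that by (intro divide_left_mono mult_pos_pos) auto
    moreover have "s \<in> {v $ i - ?a .. v $ i + ?a}" using True by auto
    ultimately show ?thesis using True by (simp add: cone_weight_def nth)
  next
    case False
    then have "cone_weight i j (v - s *\<^sub>R axis i 1) = 0"
      by (simp only: cone_weight_def nth if_False)
    then show ?thesis by simp
  qed
  show ?thesis
  proof (cases "?a = 0")
    case True
    have "AE s in lborel. s \<noteq> v $ i" by (rule AE_lborel_singleton)
    then have "AE s in lborel. indicator {0..1} s * ennreal (cone_weight i j (v - s *\<^sub>R axis i 1)) = 0"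
    proof eventually_elim
      case (elim s)
      then have "\<not> \<bar>v $ i - s\<bar> \<le> \<bar>v $ j\<bar>" using True by simp
      then have "cone_weight i j (v - s *\<^sub>R axis i 1) = 0"
        by (simp only: cone_weight_def nth if_False)
      then show ?case by simp
    qed
    then have "(\<integral>\<^sup>+s. indicator {0..1} s * ennreal (cone_weight i j (v - s *\<^sub>R axis i 1)) \<partial>lborel) = (\<integral>\<^sup>+s. 0 \<partial>(lborel :: real measure))"
      by (rule nn_integral_cong_AE)
    then show ?thesis by simp
  next
    case False
    have "(\<integral>\<^sup>+s. indicator {0..1} s * ennreal (cone_weight i j (v - s *\<^sub>R axis i 1)) \<partial>lborel) \<le>
        (\<integral>\<^sup>+s. ennreal (1 / ?a) * indicator {v $ i - ?a .. v $ i + ?a} s \<partial>lborel)"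
    proof (rule nn_integral_mono)
      fix s
      have "ennreal (cone_weight i j (v - s *\<^sub>R axis i 1)) \<le> ennreal (1 / ?a * indicator {v $ i - ?a .. v $ i + ?a} s)"
        by (rule ennreal_leI[OF le[OF False]])
      also have "\<dots> = ennreal (1 / ?a) * indicator {v $ i - ?a .. v $ i + ?a} s"
        by (auto simp: indicator_def)
      finally show "indicator {0..1} s * ennreal (cone_weight i j (v - s *\<^sub>R axis i 1)) \<le> ennreal (1 / ?a) * indicator {v $ i - ?a .. v $ i + ?a} s"
        by (auto simp: indicator_def)
    qed
    also have "\<dots> = ennreal (1 / ?a) * ennreal (2 * ?a)"
      by (subst nn_integral_cmult_indicator) auto
    also have "\<dots> = 2" using False by (subst ennreal_mult[symmetric]) auto
    finally show ?thesis .
  qed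
qed

lemma inverse_norm_le_cone_weights: "1 / norm v \<le> cone_weight i j v + cone_weight j i v"
  by (auto simp: cone_weight_def)

lemma measurable_cone_weight [measurable]: "cone_weight i j \<in> borel_measurable borel"
  unfolding cone_weight_def[abs_def] by measurable

text \<open>The assumption \<open>vs\<close> says that \<open>v\<close> moves rigidly with particle
  \<open>k\<close>, which covers both the position \<open>q k\<close> and a difference
  \<open>q k - q l\<close>. Any two distinct axes would provide the covering cones; 1 and 2 are
  taken.\<close>

lemma Hardy_integrable:
  fixes v :: "config \<Rightarrow> real^3"
  assumes k [measurable]: "k < N" and \<psi>: "square_integrable (config_space N) \<psi>"
    and g: "has_weak_gradient N \<psi> g"
    and v [measurable]: "v \<in> borel_measurable (config_space N)"
    and vs: "\<And>i t q. v (shift k i t q) = v q + t *\<^sub>R axis i 1"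
  shows "integrable (config_space N) (\<lambda>q. 1 / norm (v q) * (\<psi> q)\<^sup>2)"
proof -
  have [measurable]: "\<psi> \<in> borel_measurable (config_space N)" and i\<psi>: "integrable (config_space N) (\<lambda>q. (\<psi> q)\<^sup>2)"
    using \<psi> by (auto simp: square_integrable_def)
  have sq: "square_integrable (config_space N) (g k)" using g k by (simp add: has_weak_gradient_def)
  have fin: "(\<integral>\<^sup>+q. ennreal (cone_weight i j (v q)) * ennreal ((\<psi> q)\<^sup>2) \<partial>config_space N) < \<infinity>" if ij: "i \<noteq> j" for i j
  proof -
    note sqi = square_integrable_nth[OF sq, of i]
    note [measurable] = sqi(1)
    have "(\<integral>\<^sup>+q. ennreal (cone_weight i j (v q)) * ennreal ((\<psi> q)\<^sup>2) \<partial>config_space N)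
      \<le> 2 * (2 * (\<integral>\<^sup>+q. ennreal ((\<psi> q)\<^sup>2) \<partial>config_space N)) + 2 * (2 * (\<integral>\<^sup>+q. ennreal ((g k q $ i)\<^sup>2) \<partial>config_space N))"
    proof (rule weighted_L2_bound[OF k])
      show "(\<integral>\<^sup>+s. indicator {0..1} s * ennreal (cone_weight i j (v (shift k i (- s) q))) \<partial>lborel) \<le> 2" for q
        unfolding vs using cone_weight_line[OF ij, of "v q"] by simp
      show "translates N k i \<psi> (\<lambda>q. g k q $ i) h" if "0 \<le> h" for h
        by (rule has_weak_gradient_translates[OF square_integrable_loc_int[OF \<psi>] g k that])
    qed measurable
    also have "\<dots> < \<infinity>"
      using i\<psi> sqi(2) by (simp add: nn_integral_eq_integral ennreal_mult_less_top)
    finally show ?thesis .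
  qed
  show ?thesis
  proof (rule integrableI_bounded)
    have "(\<integral>\<^sup>+q. ennreal (norm (1 / norm (v q) * (\<psi> q)\<^sup>2)) \<partial>config_space N) \<le>
        (\<integral>\<^sup>+q. ennreal (cone_weight 1 2 (v q)) * ennreal ((\<psi> q)\<^sup>2) + ennreal (cone_weight 2 1 (v q)) * ennreal ((\<psi> q)\<^sup>2) \<partial>config_space N)"
    proof (rule nn_integral_mono)
      fix q
      have nn: "0 \<le> cone_weight i j (v q)" for i j by (simp add: cone_weight_def)
      have "1 / norm (v q) * (\<psi> q)\<^sup>2 \<le> (cone_weight 1 2 (v q) + cone_weight 2 1 (v q)) * (\<psi> q)\<^sup>2"
        by (intro mult_right_mono inverse_norm_le_cone_weights) simp
      then have "ennreal (norm (1 / norm (v q) * (\<psi> q)\<^sup>2)) \<le> ennreal ((cone_weight 1 2 (v q) + cone_weight 2 1 (v q)) * (\<psi> q)\<^sup>2)"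
        by (intro ennreal_leI) simp
      also have "\<dots> = ennreal (cone_weight 1 2 (v q)) * ennreal ((\<psi> q)\<^sup>2) + ennreal (cone_weight 2 1 (v q)) * ennreal ((\<psi> q)\<^sup>2)"
        using nn by (simp add: distrib_right ennreal_mult)
      finally show "ennreal (norm (1 / norm (v q) * (\<psi> q)\<^sup>2)) \<le> \<dots>" .
    qed
    also have "\<dots> < \<infinity>"
      using fin[of 1 2] fin[of 2 1] by (subst nn_integral_add) auto
    finally show "(\<integral>\<^sup>+q. ennreal (norm (1 / norm (v q) * (\<psi> q)\<^sup>2)) \<partial>config_space N) < \<infinity>" .
  qed measurable
qed

section \<open>Permutations and slices\<close>

lemma shift_comp_permutes:
  assumes "s permutes {..<N}"
  shows "shift k i t (q \<circ> s) = shift (s k) i t q \<circ> s"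
  using permutes_inj[OF assms] by (auto simp: shift_def fun_eq_iff inj_def)

text \<open>Moving particle \<open>k\<close> in \<open>q\<close> moves particle
  \<open>inv s k\<close> in \<open>q \<circ> s\<close>. Hence the permuted blocks satisfy the
  translation identities of the symmetric function \<psi>, and uniqueness identifies them with
  \<open>g\<close>.\<close>

lemma weak_gradient_permute:
  assumes \<psi>: "loc_int N \<psi>" and g: "has_weak_gradient N \<psi> g" and s: "s permutes {..<N}"
    and sym: "AE q in config_space N. \<psi> (q \<circ> s) = \<psi> q" and j: "j < N"
  shows "AE q in config_space N. g j q = g (inv s j) (q \<circ> s)"
proof -
  note p = distr_permute[OF s]
  have inv_less: "inv s k < N" if "k < N" for k
    using permutes_in_image[OF permutes_inv[OF s], of k] that by simp
  have sq: "square_integrable (config_space N) (\<lambda>q. g (inv s k) (q \<circ> s))" if k: "k < N" for k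
  proof -
    have "square_integrable (config_space N) (g (inv s k))"
      using g inv_less[OF k] by (simp add: has_weak_gradient_def)
    then show ?thesis
      using measurable_compose[OF p(2)] integrable_preserving[OF p]
      unfolding square_integrable_def by blast
  qed
  have "has_weak_gradient N \<psi> (\<lambda>k q. g (inv s k) (q \<circ> s))"
  proof (rule has_weak_gradientI[OF \<psi> sq])
    fix k i n assume k: "k < N"
    let ?h = "1 / real (Suc n)"
    have "translates N (inv s k) i \<psi> (\<lambda>q. g (inv s k) q $ i) ?h"
      by (rule has_weak_gradient_translates[OF \<psi> g inv_less[OF k]]) simp
    from AE_preserving[OF p this[unfolded translates_def]]
    have "AE q in config_space N. \<psi> (shift k i ?h q \<circ> s) - \<psi> (q \<circ> s) = line_int k i ?h (\<lambda>q. g (inv s k) (q \<circ> s) $ i) q"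
      by (simp add: shift_comp_permutes[OF s] permutes_inverses(1)[OF s] line_int_def)
    moreover have "AE q in config_space N. \<psi> (shift k i ?h q \<circ> s) = \<psi> (shift k i ?h q)"
      by (rule AE_preserving[OF distr_shift[OF k] shift_measurable[OF k] sym])
    ultimately show "translates N k i \<psi> (\<lambda>q. g (inv s k) (q \<circ> s) $ i) ?h"
      using sym unfolding translates_def by eventually_elim simp
  qed
  from weak_gradient_unique[OF \<psi> \<psi> _ g this j] show ?thesis by simp
qed

lemma kinetic_permute:
  assumes "loc_int N \<psi>" and g: "has_weak_gradient N \<psi> g" and s: "s permutes {..<N}"
    and "AE q in config_space N. \<psi> (q \<circ> s) = \<psi> q" and k: "k < N"
  shows "(LINT q|config_space N. (norm (g (s k) q))\<^sup>2) = (LINT q|config_space N. (norm (g k q))\<^sup>2)"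
proof -
  note p = distr_permute[OF s]
  have sk: "s k < N" using permutes_in_image[OF s, of k] k by simp
  have [measurable]: "g k \<in> borel_measurable (config_space N)" "g (s k) \<in> borel_measurable (config_space N)"
    using g k sk by (auto simp: has_weak_gradient_def square_integrable_def)
  note [measurable] = p(2)
  have "AE q in config_space N. g (s k) q = g k (q \<circ> s)"
    using weak_gradient_permute[OF assms(1-4) sk] by (simp add: permutes_inverses(2)[OF s])
  then have "(LINT q|config_space N. (norm (g (s k) q))\<^sup>2) = (LINT q|config_space N. (norm (g k (q \<circ> s)))\<^sup>2)"
    by (intro integral_cong_AE) auto
  also have "\<dots> = (LINT q|config_space N. (norm (g k q))\<^sup>2)"
    by (rule integral_preserving[OF p]) measurable
  finally show ?thesis .
qed

lemma potential_permute:
  fixes f \<rho> :: "config \<Rightarrow> real"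
  assumes s: "s permutes {..<N}" and [measurable]: "\<rho> \<in> borel_measurable (config_space N)" "f \<in> borel_measurable (config_space N)"
    and sym: "AE q in config_space N. \<rho> (q \<circ> s) = \<rho> q"
  shows "(LINT q|config_space N. f (q \<circ> s) * \<rho> q) = (LINT q|config_space N. f q * \<rho> q)"
proof -
  note p = distr_permute[OF s]
  note [measurable] = p(2)
  have "(LINT q|config_space N. f (q \<circ> s) * \<rho> q) = (LINT q|config_space N. f (q \<circ> s) * \<rho> (q \<circ> s))"
    by (intro integral_cong_AE) (use sym in auto)
  also have "\<dots> = (LINT q|config_space N. f q * \<rho> q)"
    by (rule integral_preserving[OF p]) measurable
  finally show ?thesis .
qed

section \<open>Freezing the last particle\<close>

lemma AE_slices:
  assumes "AE q in config_space (Suc N). P q"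
  shows "AE y in lborel. AE q in config_space N. P (q(N := y))"
  using lcs.AE_pair[OF AE_preserving[OF distr_ext ext_measurable assms]] by simp

lemma integrable_slices:
  fixes f :: "config \<Rightarrow> real"
  assumes "integrable (config_space (Suc N)) f"
  shows "AE y in lborel. integrable (config_space N) (\<lambda>q. f (q(N := y)))"
    and "integrable lborel (\<lambda>y. LINT q|config_space N. f (q(N := y)))"
    and "(LINT y|lborel. LINT q|config_space N. f (q(N := y))) = (LINT q|config_space (Suc N). f q)"
proof -
  have i: "integrable (lborel \<Otimes>\<^sub>M config_space N) (\<lambda>x. f (case x of (y, q) \<Rightarrow> q(N := y)))"
    by (rule integrable_preserving[OF distr_ext ext_measurable assms])
  show "AE y in lborel. integrable (config_space N) (\<lambda>q. f (q(N := y)))"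
    using lcs.AE_integrable_fst'[OF i] by simp
  show "integrable lborel (\<lambda>y. LINT q|config_space N. f (q(N := y)))"
    using lcs.integrable_fst'[OF i] by simp
  have "f \<in> borel_measurable (config_space (Suc N))" using assms by simp
  from integral_preserving[OF distr_ext ext_measurable this]
  show "(LINT y|lborel. LINT q|config_space N. f (q(N := y))) = (LINT q|config_space (Suc N). f q)"
    using lcs.integral_fst'[OF i] by simp
qed

lemma line_int_cmult: "line_int k i h (\<lambda>q. c * G q) q = c * line_int k i h G q"
  unfolding line_int_def by (subst integral_mult_right_zero[symmetric]) (simp add: mult.left_commute)

text \<open>Also evaluated on configurations of more than \<open>N\<close> particles: in a slice
  only the interaction of the remaining \<open>N\<close> particles counts, with their own prefactor
  \<open>1 / real N\<close>.\<close>

definition coulomb :: "real \<Rightarrow> nat \<Rightarrow> config \<Rightarrow> real" where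
  "coulomb lam N q = - lam * (\<Sum>k<N. 1 / norm (q k)) + 1 / real N * (\<Sum>l<N. \<Sum>k<l. 1 / norm (q k - q l))"

lemma measurable_coulomb [measurable]: "N \<le> M \<Longrightarrow> coulomb lam N \<in> borel_measurable (config_space M)"
  unfolding coulomb_def[abs_def]
  by (intro borel_measurable_add borel_measurable_times borel_measurable_sum borel_measurable_divide
      borel_measurable_const borel_measurable_norm borel_measurable_diff measurable_compose[OF measurable_coord borel_measurable_norm]) auto

lemma coulomb_upd [simp]: "coulomb lam N (q(N := y)) = coulomb lam N q"
  unfolding coulomb_def by (auto intro!: arg_cong2[where f="(+)"] arg_cong2[where f="(*)"] sum.cong)

lemma sum_lessThan_real: "(\<Sum>l<n. real l) = real n * (real n - 1) / 2"
  by (induction n) (simp_all add: field_simps)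

section \<open>Kinetic and Coulomb terms of an admissible density\<close>

context
  fixes N :: nat and \<rho> :: "config \<Rightarrow> real"
  assumes \<rho>: "\<rho> \<in> admissible_densities N"
begin

private abbreviation "\<psi> \<equiv> \<lambda>q. sqrt (\<rho> q)"
private abbreviation "g \<equiv> weak_gradient N \<psi>"

lemma density_integrable: "integrable (config_space N) \<rho>" "(LINT q|config_space N. \<rho> q) = 1"
  using \<rho> by (auto simp: admissible_densities_def has_bochner_integral_iff)

lemma density_nonneg: "AE q in config_space N. 0 \<le> \<rho> q"
  using \<rho> by (simp add: admissible_densities_def)

lemma density_permute: "s permutes {..<N} \<Longrightarrow> AE q in config_space N. \<rho> (q \<circ> s) = \<rho> q"
  using \<rho> by (simp add: admissible_densities_def)

lemma density_measurable: "\<rho> \<in> borel_measurable (config_space N)"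
  using density_integrable by simp

lemma sqrt_density_square_integrable: "square_integrable (config_space N) \<psi>"
  using \<rho> by (simp add: admissible_densities_def H1_def)

lemma sqrt_density_gradient: "has_weak_gradient N \<psi> g"
proof -
  have "\<exists>g. has_weak_gradient N \<psi> g"
    using \<rho> by (simp add: admissible_densities_def H1_def)
  then show ?thesis unfolding weak_gradient_def by (rule someI_ex)
qed

lemma gradient_integrable: "k < N \<Longrightarrow> integrable (config_space N) (\<lambda>q. (norm (g k q))\<^sup>2)"
  using sqrt_density_gradient by (simp add: has_weak_gradient_def square_integrable_def)

lemma kinetic_eq:
  assumes "k < N"
  shows "(LINT q|config_space N. (norm (g k q))\<^sup>2) = (LINT q|config_space N. (norm (g 0 q))\<^sup>2)"
proof -
  have s: "Transposition.transpose 0 k permutes {..<N}" using assms by (intro permutes_swap_id) auto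
  have "AE q in config_space N. \<psi> (q \<circ> Transposition.transpose 0 k) = \<psi> q"
    using density_permute[OF s] by eventually_elim simp
  from kinetic_permute[OF square_integrable_loc_int[OF sqrt_density_square_integrable] sqrt_density_gradient s this, of 0] assms
  show ?thesis by simp
qed

lemma Hardy_density:
  fixes v :: "config \<Rightarrow> real^3"
  assumes "k < N" "v \<in> borel_measurable (config_space N)" "\<And>i t q. v (shift k i t q) = v q + t *\<^sub>R axis i 1"
  shows "integrable (config_space N) (\<lambda>q. 1 / norm (v q) * \<rho> q)"
proof -
  have i: "integrable (config_space N) (\<lambda>q. 1 / norm (v q) * (\<psi> q)\<^sup>2)"
    by (rule Hardy_integrable[OF assms(1) sqrt_density_square_integrable sqrt_density_gradient assms(2,3)])
  have "AE q in config_space N. 1 / norm (v q) * (\<psi> q)\<^sup>2 = 1 / norm (v q) * \<rho> q"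
    using density_nonneg by eventually_elim simp
  then show ?thesis
    by (rule integrable_cong_AE_imp[OF i, rotated])
      (intro borel_measurable_times borel_measurable_divide borel_measurable_const
        measurable_compose[OF assms(2) borel_measurable_norm] density_measurable)
qed

lemma nucleus_integrable: "k < N \<Longrightarrow> integrable (config_space N) (\<lambda>q. 1 / norm (q k) * \<rho> q)"
  by (rule Hardy_density[where k=k and v="\<lambda>q. q k"]) (simp_all add: shift_def measurable_coord)

lemma repulsion_integrable:
  "k < N \<Longrightarrow> l < N \<Longrightarrow> k \<noteq> l \<Longrightarrow> integrable (config_space N) (\<lambda>q. 1 / norm (q k - q l) * \<rho> q)"
  by (rule Hardy_density[where k=k and v="\<lambda>q. q k - q l"]) (simp_all add: shift_def measurable_coord)

lemma nucleus_eq: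
  assumes "k < N"
  shows "(LINT q|config_space N. 1 / norm (q k) * \<rho> q) = (LINT q|config_space N. 1 / norm (q 0) * \<rho> q)"
proof -
  have s: "Transposition.transpose 0 k permutes {..<N}" using assms by (intro permutes_swap_id) auto
  have N: "0 < N" using assms by simp
  from potential_permute[OF s density_measurable _ density_permute[OF s], of "\<lambda>q. 1 / norm (q 0)"] N
  show ?thesis by simp
qed

lemma repulsion_eq:
  assumes "k < l" "l < N"
  shows "(LINT q|config_space N. 1 / norm (q k - q l) * \<rho> q) = (LINT q|config_space N. 1 / norm (q 0 - q 1) * \<rho> q)"
proof -
  \<comment> \<open>The order matters when \<open>k = 1\<close>: swapping 1 and \<open>l\<close>
    first fixes 0 and sends 1 to \<open>l\<close>, which the swap of 0 and \<open>k\<close> then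
    leaves alone.\<close>
  let ?s = "Transposition.transpose 0 k \<circ> Transposition.transpose 1 l"
  have s: "?s permutes {..<N}" using assms by (intro permutes_compose permutes_swap_id) auto
  have N: "0 < N" "1 < N" using assms by auto
  have e: "?s 0 = k" "?s 1 = l" using assms by (auto simp: transpose_def)
  have "(\<lambda>q. 1 / norm (q 0 - q 1)) \<in> borel_measurable (config_space N)" using N by measurable
  from potential_permute[OF s density_measurable this density_permute[OF s]]
  show ?thesis unfolding o_apply e[unfolded o_apply] by simp
qed

text \<open>By symmetry all \<open>n (n - 1) / 2\<close> pairs contribute equally, and the prefactor
  \<open>1 / n\<close> leaves \<open>(n - 1) / 2\<close>. For \<open>n = 1\<close> this factor is 0,
  which covers the case \<open>N = 1\<close>, where \<open>q 1\<close> is not the position of a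
  particle.\<close>

lemma coulomb_integrable:
  assumes "n \<le> N" and n: "0 < n"
  shows "integrable (config_space N) (\<lambda>q. coulomb lam n q * \<rho> q)"
    and "(LINT q|config_space N. coulomb lam n q * \<rho> q) =
      - lam * real n * (LINT q|config_space N. 1 / norm (q 0) * \<rho> q) +
      (real n - 1) / 2 * (LINT q|config_space N. 1 / norm (q 0 - q 1) * \<rho> q)"
proof -
  let ?A = "LINT q|config_space N. 1 / norm (q 0) * \<rho> q"
  let ?R = "LINT q|config_space N. 1 / norm (q 0 - q 1) * \<rho> q"
  have e: "(\<lambda>q. coulomb lam n q * \<rho> q) = (\<lambda>q. - lam * (\<Sum>k<n. 1 / norm (q k) * \<rho> q) +
      1 / real n * (\<Sum>l<n. \<Sum>k<l. 1 / norm (q k - q l) * \<rho> q))"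
    by (rule ext) (simp only: coulomb_def distrib_right sum_distrib_right mult.assoc)
  have i1: "integrable (config_space N) (\<lambda>q. 1 / norm (q k) * \<rho> q)" if "k < n" for k
    using that assms by (intro nucleus_integrable) auto
  have i2: "integrable (config_space N) (\<lambda>q. 1 / norm (q k - q l) * \<rho> q)" if "l < n" "k < l" for k l
    using that assms by (intro repulsion_integrable) auto
  have I1: "integrable (config_space N) (\<lambda>q. \<Sum>k<n. 1 / norm (q k) * \<rho> q)"
    using i1 by (intro Bochner_Integration.integrable_sum) auto
  have I2: "integrable (config_space N) (\<lambda>q. \<Sum>l<n. \<Sum>k<l. 1 / norm (q k - q l) * \<rho> q)"
    using i2 by (intro Bochner_Integration.integrable_sum) auto
  show "integrable (config_space N) (\<lambda>q. coulomb lam n q * \<rho> q)"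
    unfolding e by (intro Bochner_Integration.integrable_add integrable_mult_right I1 I2)
  have "(LINT q|config_space N. (\<Sum>k<n. 1 / norm (q k) * \<rho> q)) = (\<Sum>k<n. ?A)"
    by (rule trans[OF Bochner_Integration.integral_sum sum.cong[OF refl nucleus_eq]]) (use i1 assms in auto)
  moreover have "(LINT q|config_space N. (\<Sum>l<n. \<Sum>k<l. 1 / norm (q k - q l) * \<rho> q)) = (\<Sum>l<n. \<Sum>k<l. ?R)"
  proof (rule trans[OF Bochner_Integration.integral_sum sum.cong[OF refl]])
    fix l assume l: "l \<in> {..<n}"
    then show "integrable (config_space N) (\<lambda>q. \<Sum>k<l. 1 / norm (q k - q l) * \<rho> q)"
      using i2 by (intro Bochner_Integration.integrable_sum) auto
    show "(LINT q|config_space N. (\<Sum>k<l. 1 / norm (q k - q l) * \<rho> q)) = (\<Sum>k<l. ?R)"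
      by (rule trans[OF Bochner_Integration.integral_sum sum.cong[OF refl repulsion_eq]]) (use i2 l assms in auto)
  qed
  moreover have "(\<Sum>l<n. \<Sum>k<l. ?R) = (\<Sum>l<n. real l) * ?R"
    by (simp add: sum_distrib_right)
  moreover have "(LINT q|config_space N. coulomb lam n q * \<rho> q) =
      - lam * (LINT q|config_space N. (\<Sum>k<n. 1 / norm (q k) * \<rho> q)) +
      1 / real n * (LINT q|config_space N. (\<Sum>l<n. \<Sum>k<l. 1 / norm (q k - q l) * \<rho> q))"
    unfolding e using Bochner_Integration.integral_add[OF integrable_mult_right[OF I1, of "- lam"] integrable_mult_right[OF I2, of "1 / real n"]]
    by (simp only: integral_mult_right_zero)
  ultimately have "(LINT q|config_space N. coulomb lam n q * \<rho> q) = - lam * (\<Sum>k<n. ?A) + 1 / real n * (real n * (real n - 1) / 2 * ?R)"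
    by (simp only: sum_lessThan_real)
  then show "(LINT q|config_space N. coulomb lam n q * \<rho> q) = - lam * real n * ?A + (real n - 1) / 2 * ?R"
    using n by simp
qed

end

section \<open>Energy of normalised slices\<close>

lemma energy_coulomb:
  "energy hbar m e z lam N \<rho> =
    hbar\<^sup>2 / (8 * m) * (4 * (LINT q|config_space N. (\<Sum>k<N. (norm (weak_gradient N (\<lambda>q. sqrt (\<rho> q)) k q))\<^sup>2))) +
    z\<^sup>2 * e\<^sup>2 * (LINT q|config_space N. coulomb lam N q * \<rho> q)"
  by (simp add: energy_def coulomb_def)

section \<open>Normalising a slice of positive mass \<open>M\<close>\<close>

context
  fixes N :: nat and r :: "config \<Rightarrow> real" and G :: "nat \<Rightarrow> config \<Rightarrow> real^3" and M :: real
  assumes r: "integrable (config_space N) r" "AE q in config_space N. 0 \<le> r q"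
    and M: "M = (LINT q|config_space N. r q)" "0 < M"
    and sym: "\<And>s. s permutes {..<N} \<Longrightarrow> AE q in config_space N. r (q \<circ> s) = r q"
    and G: "\<And>k. k < N \<Longrightarrow> square_integrable (config_space N) (G k)"
    and tr: "\<And>k i n. k < N \<Longrightarrow> translates N k i (\<lambda>q. sqrt (r q)) (\<lambda>q. G k q $ i) (1 / real (Suc n))"
begin

lemma sqrt_normalized_square_integrable: "square_integrable (config_space N) (\<lambda>q. sqrt (r q / M))"
proof -
  have [measurable]: "r \<in> borel_measurable (config_space N)" using r by simp
  have i: "integrable (config_space N) (\<lambda>q. r q / M)" using r by simp
  have "AE q in config_space N. r q / M = (norm (sqrt (r q / M)))\<^sup>2"
    using r(2) by eventually_elim (use M in simp)
  then have "integrable (config_space N) (\<lambda>q. (norm (sqrt (r q / M)))\<^sup>2)"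
    by (rule integrable_cong_AE_imp[OF i, rotated]) measurable
  then show ?thesis unfolding square_integrable_def by simp
qed

lemma normalized_weak_gradient:
  "has_weak_gradient N (\<lambda>q. sqrt (r q / M)) (\<lambda>k q. (1 / sqrt M) *\<^sub>R G k q)"
proof (rule has_weak_gradientI[OF square_integrable_loc_int[OF sqrt_normalized_square_integrable]])
  fix k assume k: "k < N"
  show "square_integrable (config_space N) (\<lambda>q. (1 / sqrt M) *\<^sub>R G k q)"
    using G[OF k] unfolding square_integrable_def by (auto simp: power_mult_distrib power_divide)
  fix i n
  have "AE q in config_space N. sqrt (r (shift k i (1 / real (Suc n)) q)) - sqrt (r q) = line_int k i (1 / real (Suc n)) (\<lambda>q. G k q $ i) q"
    using tr[OF k] unfolding translates_def .
  then show "translates N k i (\<lambda>q. sqrt (r q / M)) (\<lambda>q. ((1 / sqrt M) *\<^sub>R G k q) $ i) (1 / real (Suc n))"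
    unfolding translates_def vector_scaleR_component real_scaleR_def line_int_cmult
  proof eventually_elim
    case (elim q)
    have "sqrt (r (shift k i (1 / real (Suc n)) q) / M) - sqrt (r q / M) =
        1 / sqrt M * (sqrt (r (shift k i (1 / real (Suc n)) q)) - sqrt (r q))"
      by (simp add: real_sqrt_divide diff_divide_distrib)
    then show ?case unfolding elim .
  qed
qed

lemma normalized_admissible: "(\<lambda>q. r q / M) \<in> admissible_densities N"
  unfolding admissible_densities_def mem_Collect_eq
proof (intro conjI allI impI)
  show "AE q in config_space N. 0 \<le> r q / M"
    using r(2) by eventually_elim (use M in simp)
  show "has_bochner_integral (config_space N) (\<lambda>q. r q / M) 1"
    using r M by (simp add: has_bochner_integral_iff)
  show "AE q in config_space N. r (q \<circ> s) / M = r q / M" if "s permutes {..<N}" for s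
    using sym[OF that] by eventually_elim simp
  show "(\<lambda>q. sqrt (r q / M)) \<in> H1 N"
    using sqrt_normalized_square_integrable normalized_weak_gradient unfolding H1_def by blast
qed

text \<open>The energy is homogeneous of degree one in the density: the gradient of the square root
  scales by \<open>1 / sqrt M\<close> and enters squared. Multiplying by the mass therefore restores
  the unnormalised slice exactly, which is what makes averaging over \<open>y\<close>
  linear.\<close>

lemma energy_normalized:
  "energy hbar m e z lam N (\<lambda>q. r q / M) =
    (hbar\<^sup>2 / (8 * m) * (4 * (LINT q|config_space N. (\<Sum>k<N. (norm (G k q))\<^sup>2))) +
    z\<^sup>2 * e\<^sup>2 * (LINT q|config_space N. coulomb lam N q * r q)) / M"
proof -
  let ?g = "weak_gradient N (\<lambda>q. sqrt (r q / M))"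
  have L: "loc_int N (\<lambda>q. sqrt (r q / M))"
    by (rule square_integrable_loc_int[OF sqrt_normalized_square_integrable])
  have wg: "has_weak_gradient N (\<lambda>q. sqrt (r q / M)) ?g"
    by (rule sqrt_density_gradient[OF normalized_admissible])
  have eq: "AE q in config_space N. ?g k q = (1 / sqrt M) *\<^sub>R G k q" if "k < N" for k
    by (rule weak_gradient_unique[OF L L _ wg normalized_weak_gradient that]) simp
  have [measurable]: "k < N \<Longrightarrow> ?g k \<in> borel_measurable (config_space N)" "k < N \<Longrightarrow> G k \<in> borel_measurable (config_space N)" for k
    using wg G by (auto simp: has_weak_gradient_def square_integrable_def)
  have "AE q in config_space N. \<forall>k\<in>{..<N}. ?g k q = (1 / sqrt M) *\<^sub>R G k q"
    using eq by (intro AE_finite_allI) auto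
  then have "AE q in config_space N. (\<Sum>k<N. (norm (?g k q))\<^sup>2) = (\<Sum>k<N. (norm (G k q))\<^sup>2) / M"
  proof eventually_elim
    case (elim q)
    have "(\<Sum>k<N. (norm (?g k q))\<^sup>2) = (\<Sum>k<N. (norm (G k q))\<^sup>2 / M)"
      by (rule sum.cong[OF refl]) (use elim M in \<open>simp add: power_divide\<close>)
    then show ?case by (simp add: sum_divide_distrib)
  qed
  then have "(LINT q|config_space N. (\<Sum>k<N. (norm (?g k q))\<^sup>2)) = (LINT q|config_space N. (\<Sum>k<N. (norm (G k q))\<^sup>2) / M)"
    by (intro integral_cong_AE borel_measurable_sum borel_measurable_divide) measurable
  then show ?thesis
    unfolding energy_coulomb by (simp add: add_divide_distrib)
qed

end

lemma slice_energy:
  fixes \<rho> :: "config \<Rightarrow> real"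
  assumes N: "0 < N" and \<rho>: "\<rho> \<in> admissible_densities (Suc N)" and m: "0 \<le> m"
    and c: "\<And>\<rho>'. \<rho>' \<in> admissible_densities N \<Longrightarrow> c \<le> 1 / real N * energy hbar m e z lam N \<rho>'"
  defines "g \<equiv> weak_gradient (Suc N) (\<lambda>q. sqrt (\<rho> q))"
  shows "AE y in lborel. c * real N * (LINT q|config_space N. \<rho> (q(N := y))) \<le>
    hbar\<^sup>2 / (8 * m) * (4 * (LINT q|config_space N. (\<Sum>k<N. (norm (g k (q(N := y))))\<^sup>2))) +
    z\<^sup>2 * e\<^sup>2 * (LINT q|config_space N. coulomb lam N q * \<rho> (q(N := y)))"
proof -
  note L = square_integrable_loc_int[OF sqrt_density_square_integrable[OF \<rho>]]
  note G = sqrt_density_gradient[OF \<rho>, folded g_def]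
  have gm: "g k \<in> borel_measurable (config_space (Suc N))" if "k < N" for k
    using G that by (simp add: has_weak_gradient_def square_integrable_def)
  have 1: "AE y in lborel. integrable (config_space N) (\<lambda>q. \<rho> (q(N := y)))"
    by (rule integrable_slices(1)[OF density_integrable(1)[OF \<rho>]])
  have 2: "AE y in lborel. AE q in config_space N. 0 \<le> \<rho> (q(N := y))"
    by (rule AE_slices[OF density_nonneg[OF \<rho>]])
  have "AE y in lborel. AE q in config_space N. \<rho> ((q \<circ> s)(N := y)) = \<rho> (q(N := y))" if s: "s permutes {..<N}" for s
  proof -
    have "s permutes {..<Suc N}" by (rule permutes_subset[OF s]) auto
    from AE_slices[OF density_permute[OF \<rho> this]]
    have "AE y in lborel. AE q in config_space N. \<rho> (q(N := y) \<circ> s) = \<rho> (q(N := y))" .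
    moreover have "q(N := y) \<circ> s = (q \<circ> s)(N := y)" for q :: config and y
      using permutes_not_in[OF s, of N] permutes_inj[OF s] by (auto simp: fun_eq_iff inj_def)
    ultimately show ?thesis by simp
  qed
  then have 3: "AE y in lborel. \<forall>s\<in>{s. s permutes {..<N}}. AE q in config_space N. \<rho> ((q \<circ> s)(N := y)) = \<rho> (q(N := y))"
    by (intro AE_finite_allI finite_permutations) auto
  have 4: "AE y in lborel. \<forall>k\<in>{..<N}. integrable (config_space N) (\<lambda>q. (norm (g k (q(N := y))))\<^sup>2)"
    unfolding g_def by (intro AE_finite_allI integrable_slices(1) gradient_integrable[OF \<rho>]) auto
  have "AE y in lborel. translates N k i (\<lambda>q. sqrt (\<rho> (q(N := y)))) (\<lambda>q. g k (q(N := y)) $ i) (1 / real (Suc n))"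
    if k: "k < N" for k i n
  proof -
    have "translates (Suc N) k i (\<lambda>q. sqrt (\<rho> q)) (\<lambda>q. g k q $ i) (1 / real (Suc n))"
      by (rule has_weak_gradient_translates[OF L G]) (use k in auto)
    from AE_slices[OF this[unfolded translates_def]] show ?thesis
      unfolding translates_def
    proof eventually_elim
      case (elim y)
      have "shift k i t (q(N := y)) = (shift k i t q)(N := y)" for q t
        using k by (auto simp: shift_def fun_eq_iff)
      with elim show ?case by (simp only: line_int_def)
    qed
  qed
  then have 5: "AE y in lborel. \<forall>k\<in>{..<N}. \<forall>i\<in>UNIV. \<forall>n. translates N k i (\<lambda>q. sqrt (\<rho> (q(N := y)))) (\<lambda>q. g k (q(N := y)) $ i) (1 / real (Suc n))"
    by (intro AE_finite_allI) (auto simp: AE_all_countable)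
  from 1 2 3 4 5 show ?thesis
  proof eventually_elim
    case (elim y)
    let ?r = "\<lambda>q. \<rho> (q(N := y))" and ?G = "\<lambda>k q. g k (q(N := y))"
    let ?M = "LINT q|config_space N. ?r q"
    let ?K = "hbar\<^sup>2 / (8 * m) * (4 * (LINT q|config_space N. (\<Sum>k<N. (norm (?G k q))\<^sup>2)))"
    let ?V = "z\<^sup>2 * e\<^sup>2 * (LINT q|config_space N. coulomb lam N q * ?r q)"
    have M0: "0 \<le> ?M" by (rule integral_nonneg_AE[OF elim(2)])
    show "c * real N * ?M \<le> ?K + ?V"
    proof (cases "?M = 0")
      case True
      \<comment> \<open>Without mass there is nothing to normalise; the slice vanishes almost
        everywhere, so its Coulomb term is 0 and the kinetic term is nonnegative anyway.\<close>
      then have "AE q in config_space N. ?r q = 0"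
        using integral_nonneg_eq_0_iff_AE[OF elim(1,2)] by simp
      then have "AE q in config_space N. coulomb lam N q * ?r q = 0" by eventually_elim simp
      then have "(LINT q|config_space N. coulomb lam N q * ?r q) = 0"
        by (rule integral_eq_zero_AE)
      moreover have "0 \<le> ?K"
        using m by (intro mult_nonneg_nonneg divide_nonneg_nonneg Bochner_Integration.integral_nonneg sum_nonneg) auto
      ultimately show ?thesis using True by simp
    next
      case False
      with M0 have M: "0 < ?M" by simp
      have ext: "(\<lambda>q. q(N := y)) \<in> config_space N \<rightarrow>\<^sub>M config_space (Suc N)" by measurable
      have sq: "square_integrable (config_space N) (?G k)" if "k < N" for k
        using elim(4) that measurable_compose[OF ext gm[OF that]] by (simp add: square_integrable_def)
      have s: "\<And>s. s permutes {..<N} \<Longrightarrow> AE q in config_space N. ?r (q \<circ> s) = ?r q"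
        using elim(3) by simp
      have t: "\<And>k i n. k < N \<Longrightarrow> translates N k i (\<lambda>q. sqrt (?r q)) (\<lambda>q. ?G k q $ i) (1 / real (Suc n))"
        using elim(5) by simp
      have "c \<le> 1 / real N * energy hbar m e z lam N (\<lambda>q. ?r q / ?M)"
        by (rule c[OF normalized_admissible[OF elim(1,2) refl M s sq t]])
      also have "\<dots> = 1 / real N * ((?K + ?V) / ?M)"
        by (subst energy_normalized[OF elim(1,2) refl M s sq t]) simp_all
      finally have "c * (real N * ?M) \<le> ?K + ?V"
        using N M by (simp add: pos_le_divide_eq mult.commute mult.left_commute)
      then show ?thesis by (simp add: mult.assoc)
    qed
  qed
qed

lemma energy_per_particle_step:
  assumes N: "0 < N" and \<rho>: "\<rho> \<in> admissible_densities (Suc N)" and m: "0 \<le> m"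
    and c: "\<And>\<rho>'. \<rho>' \<in> admissible_densities N \<Longrightarrow> c \<le> 1 / real N * energy hbar m e z lam N \<rho>'"
  shows "c \<le> 1 / real (Suc N) * energy hbar m e z lam (Suc N) \<rho>"
proof -
  let ?S = "config_space (Suc N)"
  define g where "g = weak_gradient (Suc N) (\<lambda>q. sqrt (\<rho> q))"
  define a where "a = hbar\<^sup>2 / (8 * m) * 4"
  define b where "b = z\<^sup>2 * e\<^sup>2"
  define T where "T = (LINT q|?S. (norm (g 0 q))\<^sup>2)"
  define A where "A = (LINT q|?S. 1 / norm (q 0) * \<rho> q)"
  define R where "R = (LINT q|?S. 1 / norm (q 0 - q 1) * \<rho> q)"
  have gi: "integrable ?S (\<lambda>q. (norm (g k q))\<^sup>2)" if "k < Suc N" for k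
    unfolding g_def by (rule gradient_integrable[OF \<rho> that])
  \<comment> \<open>\<open>n = N\<close> serves the averaged slices, \<open>n = Suc N\<close> the
    full energy.\<close>
  have K: "integrable ?S (\<lambda>q. \<Sum>k<n. (norm (g k q))\<^sup>2)"
    "(LINT q|?S. (\<Sum>k<n. (norm (g k q))\<^sup>2)) = real n * T" if n: "n \<le> Suc N" for n
  proof -
    show "integrable ?S (\<lambda>q. \<Sum>k<n. (norm (g k q))\<^sup>2)"
      using gi n by (intro Bochner_Integration.integrable_sum) auto
    have "(LINT q|?S. (norm (g k q))\<^sup>2) = T" if "k < n" for k
      unfolding T_def g_def by (rule kinetic_eq[OF \<rho>]) (use that n in simp)
    then have "(\<Sum>k<n. LINT q|?S. (norm (g k q))\<^sup>2) = (\<Sum>k<n. T)"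
      by (intro sum.cong) auto
    moreover have "(LINT q|?S. (\<Sum>k<n. (norm (g k q))\<^sup>2)) = (\<Sum>k<n. LINT q|?S. (norm (g k q))\<^sup>2)"
      by (rule Bochner_Integration.integral_sum) (rule gi, use n in simp)
    ultimately have "(LINT q|?S. (\<Sum>k<n. (norm (g k q))\<^sup>2)) = (\<Sum>k<n. T)" by simp
    then show "(LINT q|?S. (\<Sum>k<n. (norm (g k q))\<^sup>2)) = real n * T" by simp
  qed
  have V: "integrable ?S (\<lambda>q. coulomb lam n q * \<rho> q)"
    "(LINT q|?S. coulomb lam n q * \<rho> q) = - lam * real n * A + (real n - 1) / 2 * R" if "n \<le> Suc N" "0 < n" for n
    unfolding A_def R_def using coulomb_integrable[OF \<rho> that] by auto
  have R0: "0 \<le> R" unfolding R_def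
    by (rule integral_nonneg_AE) (use density_nonneg[OF \<rho>] in \<open>eventually_elim, simp\<close>)
  note sK = integrable_slices[OF K(1)[of N]] and sV = integrable_slices[OF V(1)[of N]]
    and s\<rho> = integrable_slices[OF density_integrable(1)[OF \<rho>]]
  \<comment> \<open>The masses of the slices integrate to 1.\<close>
  have "c * real N = (LINT y|lborel. c * real N * (LINT q|config_space N. \<rho> (q(N := y))))"
    using s\<rho>(3) density_integrable(2)[OF \<rho>] by simp
  also have "\<dots> \<le> (LINT y|lborel. a * (LINT q|config_space N. (\<Sum>k<N. (norm (g k (q(N := y))))\<^sup>2)) +
      b * (LINT q|config_space N. coulomb lam N q * \<rho> (q(N := y))))"
  proof (rule integral_mono_AE)
    show "integrable lborel (\<lambda>y. c * real N * (LINT q|config_space N. \<rho> (q(N := y))))"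
      using s\<rho>(2) by simp
    show "integrable lborel (\<lambda>y. a * (LINT q|config_space N. (\<Sum>k<N. (norm (g k (q(N := y))))\<^sup>2)) +
      b * (LINT q|config_space N. coulomb lam N q * \<rho> (q(N := y))))"
      using sK(2) sV(2) N by simp
    show "AE y in lborel. c * real N * (LINT q|config_space N. \<rho> (q(N := y))) \<le>
      a * (LINT q|config_space N. (\<Sum>k<N. (norm (g k (q(N := y))))\<^sup>2)) +
      b * (LINT q|config_space N. coulomb lam N q * \<rho> (q(N := y)))"
      using slice_energy[OF N \<rho> m c] unfolding a_def b_def g_def by (simp add: mult.assoc)
  qed
  \<comment> \<open>The averaged slices retain \<open>N\<close> of the \<open>Suc N\<close> equal
    kinetic and nuclear terms, and the pairs among \<open>N\<close> particles with weight
    \<open>1 / N\<close>.\<close>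
  also have "\<dots> = a * (real N * T) + b * (- lam * real N * A + (real N - 1) / 2 * R)"
    using sK(2,3) sV(2,3) N K(2)[of N] V(2)[of N] by simp
  finally have "c * real N \<le> (a * T - b * lam * A) * real N + b * ((real N - 1) / 2 * R)"
    by (simp add: algebra_simps)
  then have "c \<le> (a * T - b * lam * A) + b * R * ((real N - 1) / (2 * real N))"
    using N by (simp add: field_simps)
  \<comment> \<open>The only inequality besides that of the slices: it uses that the repulsion
    \<open>R\<close> is nonnegative, and after clearing denominators it reads
    \<open>N^2 - 1 \<le> N^2\<close>.\<close>
  also have "\<dots> \<le> (a * T - b * lam * A) + b * R * (real N / (2 * (real N + 1)))"
  proof (intro add_left_mono mult_left_mono)
    show "(real N - 1) / (2 * real N) \<le> real N / (2 * (real N + 1))"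
      using N by (simp add: field_simps)
    show "0 \<le> b * R" using R0 by (simp add: b_def)
  qed
  also have "\<dots> = 1 / real (Suc N) * energy hbar m e z lam (Suc N) \<rho>"
  proof -
    have "energy hbar m e z lam (Suc N) \<rho> = a * (real (Suc N) * T) + b * (- lam * real (Suc N) * A + real N / 2 * R)"
      unfolding energy_coulomb using K(2)[of "Suc N"] V(2)[of "Suc N"] by (simp add: a_def b_def g_def)
    then show ?thesis unfolding of_nat_Suc by (simp only:) (simp add: field_simps)
  qed
  finally show ?thesis .
qed

theorem proposition1:
  fixes hbar m e z lam :: real
  assumes "hbar > 0" and "m > 0" and "e > 0" and "z \<noteq> 0" and "lam > 0"
  shows "mono_on {1..} (\<lambda>N::nat. INF \<rho>\<in>admissible_densities N.
           ereal (1 / real N * energy hbar m e z lam N \<rho>))"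
proof -
  define I :: "nat \<Rightarrow> ereal" where
    "I N = (INF \<rho>\<in>admissible_densities N. ereal (1 / real N * energy hbar m e z lam N \<rho>))" for N
  have step: "I N \<le> I (Suc N)" if N: "0 < N" for N
    unfolding I_def[of "Suc N"]
  proof (rule INF_greatest)
    fix \<rho> assume \<rho>: "\<rho> \<in> admissible_densities (Suc N)"
    show "I N \<le> ereal (1 / real (Suc N) * energy hbar m e z lam (Suc N) \<rho>)"
    \<comment> \<open>\<open>I N\<close> has not been shown to be finite, so it is approached from
      below: each real \<open>c\<close> under it is a lower bound as required by the step lemma,
      \<infinity> is excluded and -\<infinity> is trivial.\<close>
    proof (rule dense_le)
      fix x assume x: "x < I N"
      show "x \<le> ereal (1 / real (Suc N) * energy hbar m e z lam (Suc N) \<rho>)"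
      proof (cases x)
        case (real c)
        have "c \<le> 1 / real N * energy hbar m e z lam N \<rho>'" if "\<rho>' \<in> admissible_densities N" for \<rho>'
        proof -
          have "ereal c \<le> I N" using x real by simp
          also have "\<dots> \<le> ereal (1 / real N * energy hbar m e z lam N \<rho>')"
            unfolding I_def by (rule INF_lower[OF that])
          finally show ?thesis by simp
        qed
        then have "c \<le> 1 / real (Suc N) * energy hbar m e z lam (Suc N) \<rho>"
          by (rule energy_per_particle_step[OF N \<rho> less_imp_le[OF \<open>m > 0\<close>]])
        then show ?thesis using real by (simp only: ereal_less_eq)
      qed (use x in auto)
    qed
  qed
  have "I N \<le> I M" if "1 \<le> N" "N \<le> M" for N M
    using that(2) that(1)
  proof (induction M rule: dec_induct)
    case (step M)
    have "I N \<le> I M" using step by simp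
    also have "I M \<le> I (Suc M)" using step by (intro \<open>\<And>N. 0 < N \<Longrightarrow> I N \<le> I (Suc N)\<close>) simp
    finally show ?case .
  qed simp
  then show ?thesis unfolding I_def by (intro mono_onI) auto
qed

end
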